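(* Let $N\in\mathbb{N}$, let $\boldsymbol u=(u_1,\dots,u_N)$ with $u_1<\cdots<u_N$ even integers, and let $\xi=\sum_{j=1}^N\delta_{u_j}$. Let $t,T\in\mathbb{N}$ with $t\le T$. For any bounded function $F$ that is measurable with respect to the configuration-valued path up to time $t$, the noncolliding random walk $(\Xi(\cdot),\mathbb{P}_\xi)$ satisfies $$\mathbb{E}_\xi[F(\Xi(\cdot))]=\mathrm{E}_{\boldsymbol u}\Big[F\Big(\sum_{j=1}^N\delta_{S_j(\cdot)}\Big)\mathcal{D}_\xi(T,\boldsymbol S(T))\Big]=\mathbf{E}_{\boldsymbol u}\Big[F\Big(\sum_{j=1}^N\delta_{\Re Z_j(\cdot)}\Big)\det_{1\le j,k\le N}\big[\Phi_\xi^{u_k}(Z_j(T))\big]\Big].$$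
   Context: $\mathbb{N}=\{1,2,\dots\}$, $\mathbb{N}_0=\{0\}\cup\mathbb{N}$. Under $\mathrm{P}_{\boldsymbol u}$ (expectation $\mathrm{E}_{\boldsymbol u}$), $\boldsymbol S(t)=(S_1(t),\dots,S_N(t))$, $t\in\mathbb{N}_0$, has independent components, each a simple symmetric random walk on $\mathbb{Z}$, with $S_j(0)=u_j$. $F$ is a bounded measurable function of paths $(\eta(s))_{0\le s\le t,\,s\in\mathbb{N}_0}$ of nonnegative integer-valued Radon measures $\eta(s)$ on $\mathbb{Z}$ (unlabeled configurations, multiple points allowed); in particular it depends on $\sum_j\delta_{S_j(\cdot)}$ symmetrically in the particles at each time. Noncolliding random walk: let $\mathbb{W}_N=\{\boldsymbol x\in\mathbb{R}^N:x_1<\cdots<x_N\}$, $\tau_{\boldsymbol u}=\inf\{t\ge1:\boldsymbol S(t)\notin\mathbb{W}_N\}$, $h(\boldsymbol x)=\prod_{1\le j<k\le N}(x_k-x_j)$. The noncolliding random walk $(\Xi(t),t\in\mathbb{N}_0,\mathbb{P}_\xi)$, with expectation $\mathbb{E}_\xi$, (independent walks conditioned never to collide) is the process of configurations on $\mathbb{Z}$ determined by $$\mathbb{E}_\xi[F(\Xi(\cdot))]=\mathrm{E}_{\boldsymbol u}\Big[F\Big(\sum_{j=1}^N\delta_{S_j(\cdot)}\Big)\mathbf{1}(\tau_{\boldsymbol u}>T)\frac{h(\boldsymbol S(T))}{h(\boldsymbol u)}\Big]$$ for all $T\in\mathbb{N}$ and all bounded $F$ depending only on the configurations at times in $\{0,\dots,T\}$.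 Complexification: let $\widetilde S_1,\dots,\widetilde S_N$ be i.i.d. processes, independent of $\boldsymbol S$, with $\widetilde S_j(0)=0$ and $\widetilde S_j(t)=\widetilde\zeta_j(1)+\cdots+\widetilde\zeta_j(t)$, where the $\widetilde\zeta_j(s)$ are i.i.d. with the hyperbolic secant density $\frac{1}{2\cosh(\pi x/2)}$ on $\mathbb{R}$; $\widetilde{\mathrm{E}}$ denotes expectation over the $\widetilde S_j$ only. Put $Z_j(t)=S_j(t)+i\widetilde S_j(t)$, and let $\mathbf{E}_{\boldsymbol u}$ be the expectation over both $\boldsymbol S$ and $(\widetilde S_j)_j$ (product probability space). $\Phi_\xi^{u_k}(z)=\prod_{1\le j\le N,\,j\ne k}\frac{z-u_j}{u_k-u_j}$ for $z\in\mathbb{C}$; $\mathcal{M}_\xi^{u_k}(t,S_j(t))=\widetilde{\mathrm{E}}[\Phi_\xi^{u_k}(Z_j(t))]$; $\mathcal{D}_\xi(t,\boldsymbol S(t))=\det_{1\le j,k\le N}[\mathcal{M}_\xi^{u_k}(t,S_j(t))]$. *)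

theory Defs
  imports "HOL-Probability.Probability" "Jordan_Normal_Form.Determinant"
begin

text \<open>Particle labels are \<open>0, \<dots>, N - 1\<close>; \<open>x :: nat \<Rightarrow> _\<close> stands for the vector of its values
  at these labels.\<close>

subsection \<open>Configurations on the integers\<close>

text \<open>Nonnegative integer-valued Radon measures on \<open>\<int>\<close> (the compact sets being the finite ones),
  with the \<open>\<sigma>\<close>-algebra generated by the evaluations \<open>\<eta> \<mapsto> \<eta> A\<close> at compact sets, built in the same
  way as \<^const>\<open>subprob_algebra\<close>.\<close>

definition configs :: "int measure set" where
  "configs = {\<eta>. sets \<eta> = sets (count_space UNIV) \<and>
                  (\<forall>A. finite A \<longrightarrow> (\<exists>n::nat. emeasure \<eta> A = of_nat n))}"

definition config_algebra :: "int measure measure" where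
  "config_algebra =
     (SUP A\<in>{A. finite A}. vimage_algebra configs (\<lambda>\<eta>. emeasure \<eta> A) borel)"

definition path_algebra :: "nat \<Rightarrow> (nat \<Rightarrow> int measure) measure" where
  "path_algebra t = (\<Pi>\<^sub>M s\<in>{..t}. config_algebra)"

text \<open>The image of the counting measure on the labels under \<open>x\<close>, that is, the sum of the
  point masses at \<open>x j\<close>, multiple points allowed.\<close>

definition unlabel :: "nat \<Rightarrow> (nat \<Rightarrow> int) \<Rightarrow> int measure" where
  "unlabel N x = distr (count_space {..<N}) (count_space UNIV) x"

text \<open>Paths are extensional, so that they lie in the space of \<open>path_algebra t\<close>.\<close>

definition bounded_path_functional :: "nat \<Rightarrow> ((nat \<Rightarrow> int measure) \<Rightarrow> real) \<Rightarrow> bool" where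
  "bounded_path_functional t F \<longleftrightarrow>
     F \<in> borel_measurable (path_algebra t) \<and>
     (\<exists>B. \<forall>\<eta>\<in>space (path_algebra t). \<bar>F \<eta>\<bar> \<le> B)"


subsection \<open>Independent simple symmetric random walks\<close>

definition simple_symmetric_walk :: "'a measure \<Rightarrow> int \<Rightarrow> (nat \<Rightarrow> 'a \<Rightarrow> int) \<Rightarrow> bool" where
  "simple_symmetric_walk M x X \<longleftrightarrow>
     (\<forall>t. X t \<in> measurable M (count_space UNIV)) \<and>
     (AE \<omega> in M. X 0 \<omega> = x) \<and>
     prob_space.indep_vars M (\<lambda>_. count_space UNIV) (\<lambda>t \<omega>. X (Suc t) \<omega> - X t \<omega>) UNIV \<and>
     (\<forall>t. distr M (count_space UNIV) (\<lambda>\<omega>. X (Suc t) \<omega> - X t \<omega>)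
            = measure_pmf (pmf_of_set {-1, 1}))"

definition independent_walks ::
    "nat \<Rightarrow> (nat \<Rightarrow> int) \<Rightarrow> 'a measure \<Rightarrow> (nat \<Rightarrow> nat \<Rightarrow> 'a \<Rightarrow> int) \<Rightarrow> bool" where
  "independent_walks N u M S \<longleftrightarrow>
     prob_space M \<and>
     (\<forall>j<N. simple_symmetric_walk M (u j) (S j)) \<and>
     prob_space.indep_vars M (\<lambda>_. \<Pi>\<^sub>M t\<in>UNIV. count_space UNIV) (\<lambda>j \<omega> t. S j t \<omega>) {..<N}"


subsection \<open>The noncolliding random walk\<close>

definition weyl_chamber :: "nat \<Rightarrow> (nat \<Rightarrow> real) set" where
  "weyl_chamber N = {x. \<forall>j k. j < k \<and> k < N \<longrightarrow> x j < x k}"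

definition vandermonde :: "nat \<Rightarrow> (nat \<Rightarrow> real) \<Rightarrow> real" where
  "vandermonde N x = (\<Prod>k<N. \<Prod>j<k. x k - x j)"

definition collision_time :: "nat \<Rightarrow> (nat \<Rightarrow> nat \<Rightarrow> 'a \<Rightarrow> int) \<Rightarrow> 'a \<Rightarrow> enat" where
  "collision_time N S \<omega> =
     Inf (enat ` {t. 1 \<le> t \<and> (\<lambda>j. real_of_int (S j t \<omega>)) \<notin> weyl_chamber N})"

definition noncolliding_walk ::
    "nat \<Rightarrow> (nat \<Rightarrow> int) \<Rightarrow> 'a measure \<Rightarrow> (nat \<Rightarrow> nat \<Rightarrow> 'a \<Rightarrow> int) \<Rightarrow>
     'c measure \<Rightarrow> (nat \<Rightarrow> 'c \<Rightarrow> int measure) \<Rightarrow> bool" where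
  "noncolliding_walk N u M S P \<Xi> \<longleftrightarrow>
     prob_space P \<and>
     (\<forall>s. \<Xi> s \<in> measurable P config_algebra) \<and>
     (\<forall>T\<ge>1. \<forall>F. bounded_path_functional T F \<longrightarrow>
        (\<integral>\<omega>. F (\<lambda>s\<in>{..T}. \<Xi> s \<omega>) \<partial>P) =
        (\<integral>\<omega>. F (\<lambda>s\<in>{..T}. unlabel N (\<lambda>j. S j s \<omega>))
              * of_bool (collision_time N S \<omega> > enat T)
              * (vandermonde N (\<lambda>j. real_of_int (S j T \<omega>))
                 / vandermonde N (\<lambda>j. real_of_int (u j))) \<partial>M))"


subsection \<open>Complexification\<close>

text \<open>The real part of \<open>complex_walk\<close> is integer-valued; \<open>\<lfloor>Re (complex_walk S \<zeta> j s \<omega>)\<rfloor>\<close> only turns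
  it into an element of type \<^typ>\<open>int\<close>.\<close>

definition sech_increments :: "nat \<Rightarrow> 'b measure \<Rightarrow> (nat \<Rightarrow> nat \<Rightarrow> 'b \<Rightarrow> real) \<Rightarrow> bool" where
  "sech_increments N M' \<zeta> \<longleftrightarrow>
     prob_space M' \<and>
     prob_space.indep_vars M' (\<lambda>_. borel) (\<lambda>(j, s). \<zeta> j s) ({..<N} \<times> {1..}) \<and>
     (\<forall>j<N. \<forall>s\<ge>1. distributed M' lborel (\<zeta> j s) (\<lambda>x. ennreal (1 / (2 * cosh (pi * x / 2)))))"

definition imag_walk :: "(nat \<Rightarrow> nat \<Rightarrow> 'b \<Rightarrow> real) \<Rightarrow> nat \<Rightarrow> nat \<Rightarrow> 'b \<Rightarrow> real" where
  "imag_walk \<zeta> j t \<omega>' = (\<Sum>s = 1..t. \<zeta> j s \<omega>')"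

definition complex_walk ::
    "(nat \<Rightarrow> nat \<Rightarrow> 'a \<Rightarrow> int) \<Rightarrow> (nat \<Rightarrow> nat \<Rightarrow> 'b \<Rightarrow> real) \<Rightarrow> nat \<Rightarrow> nat \<Rightarrow> 'a \<times> 'b \<Rightarrow> complex" where
  "complex_walk S \<zeta> j t = (\<lambda>(\<omega>, \<omega>'). of_int (S j t \<omega>) + \<i> * of_real (imag_walk \<zeta> j t \<omega>'))"

definition Phi :: "nat \<Rightarrow> (nat \<Rightarrow> int) \<Rightarrow> nat \<Rightarrow> complex \<Rightarrow> complex" where
  "Phi N u k z = (\<Prod>j\<in>{..<N} - {k}. (z - of_int (u j)) / (of_int (u k) - of_int (u j)))"

text \<open>Expectation over the imaginary parts only; \<open>x\<close> is the value of the real part of the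
  \<open>j\<close>-th particle at time \<open>t\<close>.\<close>

definition mart ::
    "nat \<Rightarrow> (nat \<Rightarrow> int) \<Rightarrow> 'b measure \<Rightarrow> (nat \<Rightarrow> nat \<Rightarrow> 'b \<Rightarrow> real) \<Rightarrow>
     nat \<Rightarrow> nat \<Rightarrow> nat \<Rightarrow> int \<Rightarrow> complex" where
  "mart N u M' \<zeta> k j t x =
     (\<integral>\<omega>'. Phi N u k (of_int x + \<i> * of_real (imag_walk \<zeta> j t \<omega>')) \<partial>M')"

definition det_mart ::
    "nat \<Rightarrow> (nat \<Rightarrow> int) \<Rightarrow> 'b measure \<Rightarrow> (nat \<Rightarrow> nat \<Rightarrow> 'b \<Rightarrow> real) \<Rightarrow>
     nat \<Rightarrow> (nat \<Rightarrow> int) \<Rightarrow> complex" where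
  "det_mart N u M' \<zeta> t x = Determinant.det (mat N N (\<lambda>(j, k). mart N u M' \<zeta> k j t (x j)))"

end

(*
  Two facts carry the proof. First, E (x + i Y)^l is a monic polynomial of degree l in x, so replacing
  Phi by its average over the imaginary parts only changes the monic basis in which the determinant is
  written; as Phi^{u_k}(u_j) is the identity matrix, D(T, x) = h(x) / h(u) for every x. Second, the
  walks have equal parity and hence meet when they first leave the Weyl chamber. Exchanging the labels
  of two meeting particles from then on preserves the law of the walk and the unlabelled configurations
  but changes the sign of h, so paths that collide contribute 0 to E [F h(S(T))] and the indicator of
  no collision may be dropped. The second identity is Fubini together with the independence of the rows.
*)

theory Submission
  imports Defs
begin

subsection \<open>Determinants of polynomial bases\<close>

text \<open>The reflection takes place on arrays of \<open>N * T\<close> signs, not on the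
  probability space. Up to time \<open>T\<close> the walks are almost everywhere a function of their
  increments, and all arrays are equally likely, so invariance of the law under the exchange of
  labels becomes a change of variables in a finite sum. The functional may stop at \<open>t\<close>
  while \<open>h\<close> is taken at \<open>T\<close>, since the exchange preserves the
  configurations at every time. On the analytic side the obstacle is that the imaginary parts are
  unbounded, so linearity, independence and Fubini all need integrable products. Variables with all
  moments finite form an algebra, which reduces integrability to two checks: the secant density has
  all moments, and the functional and the walks at a fixed time are almost everywhere
  bounded.\<close>

definition vandermonde_mat :: "nat \<Rightarrow> (nat \<Rightarrow> 'a :: comm_ring_1) \<Rightarrow> 'a mat" where
  "vandermonde_mat n x = mat n n (\<lambda>(j, l). x j ^ l)"

lemma vandermonde_mat_carrier [simp]: "vandermonde_mat n x \<in> carrier_mat n n"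
  by (simp add: vandermonde_mat_def)

lemma poly_eq_sum_lessThan:
  fixes p :: "'a :: comm_ring_1 poly"
  assumes "degree p < n"
  shows "poly p x = (\<Sum>i<n. coeff p i * x ^ i)"
proof -
  have "poly p x = (\<Sum>i\<le>degree p. coeff p i * x ^ i)"
    by (rule poly_altdef)
  also have "\<dots> = (\<Sum>i<n. coeff p i * x ^ i)"
    using assms by (intro sum.mono_neutral_left) (auto simp: coeff_eq_0)
  finally show ?thesis .
qed

text \<open>Expansion in powers separates the points from the polynomials. This serves both for
  monic bases and, with Lagrange polynomials at their own nodes, for finding the determinant of a
  coefficient matrix.\<close>

lemma poly_mat_eq:
  fixes p :: "nat \<Rightarrow> 'a :: comm_ring_1 poly"
  assumes "\<And>k. k < n \<Longrightarrow> degree (p k) < n"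
  shows "mat n n (\<lambda>(j, k). poly (p k) (x j)) = vandermonde_mat n x * mat n n (\<lambda>(i, k). coeff (p k) i)"
proof (rule eq_matI)
  fix j k assume "j < dim_row (vandermonde_mat n x * mat n n (\<lambda>(i, k). coeff (p k) i))"
    "k < dim_col (vandermonde_mat n x * mat n n (\<lambda>(i, k). coeff (p k) i))"
  then have jk: "j < n" "k < n" by (auto simp: vandermonde_mat_def)
  have "poly (p k) (x j) = (\<Sum>i = 0..<n. x j ^ i * coeff (p k) i)"
    using poly_eq_sum_lessThan[OF assms[OF jk(2)]] by (simp add: mult.commute lessThan_atLeast0)
  with jk show "mat n n (\<lambda>(j, k). poly (p k) (x j)) $$ (j, k) =
      (vandermonde_mat n x * mat n n (\<lambda>(i, k). coeff (p k) i)) $$ (j, k)"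
    by (simp add: vandermonde_mat_def scalar_prod_def)
qed (simp_all add: vandermonde_mat_def)

text \<open>The change of basis from the monomials is upper triangular with ones on the diagonal,
  hence of determinant 1.\<close>

lemma det_monic_poly_mat:
  fixes p :: "nat \<Rightarrow> 'a :: idom poly"
  assumes deg: "\<And>l. l < n \<Longrightarrow> degree (p l) = l" and monic: "\<And>l. l < n \<Longrightarrow> coeff (p l) l = 1"
  shows "Determinant.det (mat n n (\<lambda>(j, l). poly (p l) (x j))) = Determinant.det (vandermonde_mat n x)"
proof -
  define A where "A = mat n n (\<lambda>(i, k). coeff (p k) i)"
  have A: "A \<in> carrier_mat n n" by (simp add: A_def)
  have "Determinant.det A = prod_list (diag_mat A)"
    using deg by (intro det_upper_triangular[of _ n]) (auto simp: A_def upper_triangular_def coeff_eq_0)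
  also have "\<dots> = 1"
    unfolding prod_list_diag_prod using monic by (simp add: A_def)
  finally have "Determinant.det A = 1" .
  then show ?thesis
    using det_mult[OF vandermonde_mat_carrier A, of x] deg
    by (subst poly_mat_eq) (auto simp: A_def)
qed

text \<open>The Newton polynomials at the nodes \<open>x\<close> make the matrix of values lower triangular.\<close>

lemma det_vandermonde_mat:
  fixes x :: "nat \<Rightarrow> 'a :: idom"
  shows "Determinant.det (vandermonde_mat n x) = (\<Prod>k<n. \<Prod>j<k. x k - x j)"
proof -
  define p where "p l = (\<Prod>j<l. [:- x j, 1:])" for l
  have lead: "lead_coeff (p l) = 1" for l
    by (simp add: p_def lead_coeff_prod)
  have deg: "degree (p l) = l" for l
    unfolding p_def by (subst degree_prod_eq_sum_degree) auto
  have "Determinant.det (vandermonde_mat n x) = Determinant.det (mat n n (\<lambda>(j, l). poly (p l) (x j)))"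
    using lead deg by (subst det_monic_poly_mat) auto
  also have "\<dots> = prod_list (diag_mat (mat n n (\<lambda>(j, l). poly (p l) (x j))))"
    by (intro det_lower_triangular[of n]) (auto simp: p_def poly_prod)
  also have "\<dots> = (\<Prod>k<n. \<Prod>j<k. x k - x j)"
    by (simp add: prod_list_diag_prod p_def poly_prod lessThan_atLeast0)
  finally show ?thesis .
qed

lemma vandermonde_eq_det: "vandermonde n x = Determinant.det (vandermonde_mat n x)"
  by (simp add: vandermonde_def det_vandermonde_mat)

lemma of_real_vandermonde:
  "complex_of_real (vandermonde n x) = Determinant.det (vandermonde_mat n (\<lambda>j. complex_of_real (x j)))"
  by (simp add: vandermonde_def det_vandermonde_mat)

text \<open>Exchanging two labels exchanges two rows of the Vandermonde matrix; in the product the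
  sign changes of the factors would have to be counted.\<close>

lemma vandermonde_swap:
  assumes "j < n" "k < n" "j \<noteq> k"
  shows "vandermonde n (\<lambda>i. x (Transposition.transpose j k i)) = - vandermonde n x"
proof -
  let ?p = "Transposition.transpose j k"
  have p: "?p permutes {0..<n}"
    using assms by (intro permutes_swap_id) auto
  have lt: "?p i < n" if "i < n" for i
    using that permutes_in_image[OF p, of i] by simp
  have "vandermonde_mat n (\<lambda>i. x (?p i)) = mat n n (\<lambda>(i, l). vandermonde_mat n x $$ (?p i, l))"
    by (intro eq_matI) (auto simp: vandermonde_mat_def lt)
  then show ?thesis
    using assms det_permute_rows[OF vandermonde_mat_carrier p, of x]
    by (simp add: vandermonde_eq_det sign_swap_id)
qed

subsection \<open>Random variables with all moments\<close>

definition all_moments :: "'a measure \<Rightarrow> ('a \<Rightarrow> complex) \<Rightarrow> bool" where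
  "all_moments M f \<longleftrightarrow> f \<in> borel_measurable M \<and> (\<forall>n. integrable M (\<lambda>x. norm (f x) ^ n))"

lemma all_moments_measurable: "all_moments M f \<Longrightarrow> f \<in> borel_measurable M"
  by (simp add: all_moments_def)

lemma all_moments_integrable:
  assumes "all_moments M f"
  shows "integrable M f"
  using assms integrable_norm_cancel[of M f] by (auto simp: all_moments_def dest: spec[of _ 1])

lemma all_moments_AE_bounded:
  assumes "finite_measure M" "f \<in> borel_measurable M" "AE x in M. norm (f x) \<le> B"
  shows "all_moments M f"
proof -
  interpret finite_measure M by fact
  have "integrable M (\<lambda>x. norm (f x) ^ n)" for n
  proof (rule integrable_const_bound[where B = "B ^ n"])
    show "AE x in M. norm (norm (f x) ^ n) \<le> B ^ n"
      using assms(3) by eventually_elim (simp add: power_mono)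
  qed (use assms(2) in measurable)
  then show ?thesis using assms by (simp add: all_moments_def)
qed

lemma all_moments_const:
  assumes "finite_measure M"
  shows "all_moments M (\<lambda>_. c)"
  using assms by (intro all_moments_AE_bounded[where B = "norm c"]) auto

lemma all_moments_add:
  assumes f: "all_moments M f" and g: "all_moments M g"
  shows "all_moments M (\<lambda>x. f x + g x)"
proof -
  have [measurable]: "f \<in> borel_measurable M" "g \<in> borel_measurable M"
    using f g by (auto simp: all_moments_def)
  have "integrable M (\<lambda>x. norm (f x + g x) ^ n)" for n
  proof (rule Bochner_Integration.integrable_bound)
    show "integrable M (\<lambda>x. 2 ^ n * (norm (f x) ^ n + norm (g x) ^ n))"
      using f g by (auto simp: all_moments_def)
    show "AE x in M. norm (norm (f x + g x) ^ n) \<le> norm (2 ^ n * (norm (f x) ^ n + norm (g x) ^ n))"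
    proof (rule AE_I2)
      fix x
      let ?a = "norm (f x)" and ?b = "norm (g x)"
      have "norm (f x + g x) ^ n \<le> (2 * max ?a ?b) ^ n"
        using norm_triangle_ineq[of "f x" "g x"] by (intro power_mono) auto
      also have "\<dots> \<le> 2 ^ n * (?a ^ n + ?b ^ n)"
        by (auto simp: power_mult_distrib max_def)
      finally show "norm (norm (f x + g x) ^ n) \<le> norm (2 ^ n * (?a ^ n + ?b ^ n))"
        by simp
    qed
  qed measurable
  then show ?thesis by (simp add: all_moments_def)
qed

text \<open>The bound \<open>a * b \<le> a^2 + b^2\<close>, applied to \<open>n\<close>-th powers,
  pays for the \<open>n\<close>-th moment of a product with moments of order \<open>2 * n\<close>. A
  class closed under products therefore has to ask for all orders at once.\<close>

lemma all_moments_mult: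
  assumes f: "all_moments M f" and g: "all_moments M g"
  shows "all_moments M (\<lambda>x. f x * g x)"
proof -
  have [measurable]: "f \<in> borel_measurable M" "g \<in> borel_measurable M"
    using f g by (auto simp: all_moments_def)
  have "integrable M (\<lambda>x. norm (f x * g x) ^ n)" for n
  proof (rule Bochner_Integration.integrable_bound)
    show "integrable M (\<lambda>x. norm (f x) ^ (2 * n) + norm (g x) ^ (2 * n))"
      using f g by (auto simp: all_moments_def)
    show "AE x in M. norm (norm (f x * g x) ^ n) \<le> norm (norm (f x) ^ (2 * n) + norm (g x) ^ (2 * n))"
    proof (rule AE_I2)
      fix x
      let ?a = "norm (f x) ^ n" and ?b = "norm (g x) ^ n"
      have "0 \<le> ?a * ?b" by simp
      with sum_squares_bound[of ?a ?b] have "?a * ?b \<le> ?a\<^sup>2 + ?b\<^sup>2" by linarith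
      then show "norm (norm (f x * g x) ^ n) \<le> norm (norm (f x) ^ (2 * n) + norm (g x) ^ (2 * n))"
        by (simp add: norm_mult power_mult_distrib mult.commute[of 2 n] power_mult)
    qed
  qed measurable
  then show ?thesis by (simp add: all_moments_def)
qed

lemma all_moments_sum:
  assumes "finite_measure M" "\<And>i. i \<in> I \<Longrightarrow> all_moments M (f i)"
  shows "all_moments M (\<lambda>x. \<Sum>i\<in>I. f i x)"
  using assms(2) by (induction I rule: infinite_finite_induct)
    (auto intro!: all_moments_add all_moments_const[OF assms(1)])

lemma all_moments_prod:
  assumes "finite_measure M" "\<And>i. i \<in> I \<Longrightarrow> all_moments M (f i)"
  shows "all_moments M (\<lambda>x. \<Prod>i\<in>I. f i x)"
  using assms(2) by (induction I rule: infinite_finite_induct)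
    (auto intro!: all_moments_mult all_moments_const[OF assms(1)])

lemma all_moments_power:
  assumes "finite_measure M" "all_moments M f"
  shows "all_moments M (\<lambda>x. f x ^ n)"
  using all_moments_prod[OF assms(1), of "{..<n}" "\<lambda>_. f"] assms(2) by simp

lemma all_moments_det:
  assumes M: "finite_measure M" and f: "\<And>j k. j < n \<Longrightarrow> k < n \<Longrightarrow> all_moments M (f j k)"
  shows "all_moments M (\<lambda>x. Determinant.det (mat n n (\<lambda>(j, k). f j k x)))"
proof -
  have lt: "p i < n" if "p permutes {0..<n}" "i \<in> {0..<n}" for p i
    using that permutes_in_image[OF that(1), of i] by simp
  have "Determinant.det (mat n n (\<lambda>(j, k). f j k x)) =
      (\<Sum>p | p permutes {0..<n}. signof p * (\<Prod>i = 0..<n. f i (p i) x))" for x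
    by (subst det_def'[where n = n]) (auto intro!: sum.cong prod.cong dest: lt)
  then show ?thesis
    by (simp only:)
       (intro all_moments_sum all_moments_mult all_moments_prod all_moments_const M f; simp add: lt)
qed

lemma all_moments_Phi:
  assumes "finite_measure M" "all_moments M f"
  shows "all_moments M (\<lambda>x. Phi N u k (f x))"
proof -
  \<comment> \<open>Difference and quotient become sum and product with constants, the operations
    that the closure rules cover.\<close>
  have "Phi N u k (f x) = (\<Prod>j\<in>{..<N} - {k}. (f x + - of_int (u j)) * inverse (of_int (u k) - of_int (u j)))" for x
    by (simp add: Phi_def divide_inverse)
  then show ?thesis
    by (simp only:) (intro all_moments_prod all_moments_mult all_moments_add all_moments_const assms)
qed

subsection \<open>The hyperbolic secant walks\<close>

text \<open>Needed to read one row of the doubly indexed increments as a family indexed by time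
  alone. Injectivity lets sets chosen for the indices in \<open>J\<close> be carried over to the
  image of \<open>J\<close>.\<close>

lemma (in prob_space) indep_vars_reindex_inj:
  assumes inj: "inj_on f I" and X: "indep_vars M' X (f ` I)"
  shows "indep_vars (\<lambda>i. M' (f i)) (\<lambda>i. X (f i)) I"
  unfolding indep_vars_def2
proof safe
  fix i assume "i \<in> I" then show "X (f i) \<in> measurable M (M' (f i))"
    using X by (auto simp: indep_vars_def2)
next
  have ind: "indep_sets (\<lambda>i. {X i -` A \<inter> space M |A. A \<in> sets (M' i)}) (f ` I)"
    using X by (simp add: indep_vars_def2)
  show "indep_sets (\<lambda>i. {X (f i) -` A \<inter> space M |A. A \<in> sets (M' (f i))}) I"
  proof (rule indep_setsI)
    fix i assume "i \<in> I" then show "{X (f i) -` A \<inter> space M |A. A \<in> sets (M' (f i))} \<subseteq> events"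
      using ind by (auto simp: indep_sets_def)
  next
    fix A J assume J: "J \<noteq> {}" "J \<subseteq> I" "finite J"
      and A: "\<forall>j\<in>J. A j \<in> {X (f j) -` A \<inter> space M |A. A \<in> sets (M' (f j))}"
    have injJ: "inj_on f J" using inj J(2) by (rule inj_on_subset)
    let ?B = "\<lambda>k. A (the_inv_into J f k)"
    have B: "?B (f j) = A j" if "j \<in> J" for j
      using the_inv_into_f_f[OF injJ that] by simp
    have "prob (\<Inter>k\<in>f ` J. ?B k) = (\<Prod>k\<in>f ` J. prob (?B k))"
      using J A by (intro indep_setsD[OF ind]) (auto simp: B)
    then show "prob (\<Inter>j\<in>J. A j) = (\<Prod>j\<in>J. prob (A j))"
      using B by (simp add: prod.reindex[OF injJ])
  qed
qed

lemma sech_moment_integrable: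
  "integrable lborel (\<lambda>x::real. 1 / (2 * cosh (pi * x / 2)) * \<bar>x\<bar> ^ n)"
proof (rule Bochner_Integration.integrable_bound)
  have "integrable lborel (\<lambda>x::real. inverse (1 + x\<^sup>2))"
    using integrable_inverse_1_plus_square by (simp add: set_integrable_def)
  \<comment> \<open>The constant comes from \<open>\<bar>x\<bar>^n * (1 + x^2) = \<bar>x\<bar>^n +
    \<bar>x\<bar>^(n+2)\<close>, where each power \<open>\<bar>x\<bar>^m\<close> is at most
    \<open>fact m * exp \<bar>x\<bar>\<close>, being one term of the exponential series.\<close>
  then show "integrable lborel (\<lambda>x::real. (fact n + fact (n + 2)) * inverse (1 + x\<^sup>2))"
    by simp
  show "(\<lambda>x::real. 1 / (2 * cosh (pi * x / 2)) * \<bar>x\<bar> ^ n) \<in> borel_measurable lborel"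
    unfolding cosh_def by measurable
  show "AE x in lborel. norm (1 / (2 * cosh (pi * x / 2)) * \<bar>x\<bar> ^ n)
      \<le> norm ((fact n + fact (n + 2)) * inverse (1 + x\<^sup>2))"
  proof (rule AE_I2)
    fix x :: real
    have *: "\<bar>x\<bar> ^ m \<le> fact m * exp \<bar>x\<bar>" for m
    proof -
      have "(\<Sum>k\<in>{m}. \<bar>x\<bar> ^ k /\<^sub>R fact k) \<le> exp \<bar>x\<bar>"
        unfolding exp_def by (intro sum_le_suminf summable_exp_generic) auto
      then show ?thesis by (simp add: field_simps)
    qed
    \<comment> \<open>Since \<open>pi > 2\<close>, the hyperbolic cosine grows at least as fast as
      \<open>exp \<bar>x\<bar>\<close>.\<close>
    have "exp \<bar>x\<bar> \<le> exp \<bar>pi * x / 2\<bar>"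
      using pi_gt3 mult_right_mono[of 2 pi "\<bar>x\<bar>"] by (simp add: abs_mult)
    also have "\<dots> \<le> 2 * cosh (pi * x / 2)"
      unfolding cosh_def by (auto simp: abs_if)
    finally have c: "exp \<bar>x\<bar> \<le> 2 * cosh (pi * x / 2)" .
    have "\<bar>x\<bar> ^ n * (1 + x\<^sup>2) = \<bar>x\<bar> ^ n + \<bar>x\<bar> ^ (n + 2)"
      by (simp add: algebra_simps power_add power2_eq_square)
    also have "\<dots> \<le> (fact n + fact (n + 2)) * exp \<bar>x\<bar>"
      using *[of n] *[of "n + 2"] by (simp add: distrib_right)
    also have "\<dots> \<le> (fact n + fact (n + 2)) * (2 * cosh (pi * x / 2))"
      using c by (intro mult_left_mono) auto
    finally have "\<bar>x\<bar> ^ n * (1 + x\<^sup>2) \<le> (fact n + fact (n + 2)) * (2 * cosh (pi * x / 2))" .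
    moreover have "0 < 1 + x\<^sup>2" by (simp add: add_pos_nonneg)
    moreover have "0 < cosh (pi * x / 2)" by (rule cosh_real_pos)
    ultimately show "norm (1 / (2 * cosh (pi * x / 2)) * \<bar>x\<bar> ^ n)
      \<le> norm ((fact n + fact (n + 2)) * inverse (1 + x\<^sup>2))"
      by (simp add: divide_simps abs_mult)
  qed
qed

locale sech_walks = 
  fixes N :: nat and M' :: "'b measure" and \<zeta> :: "nat \<Rightarrow> nat \<Rightarrow> 'b \<Rightarrow> real"
  assumes sech_increments: "sech_increments N M' \<zeta>"
begin

sublocale prob_space M'
  using sech_increments by (simp add: sech_increments_def)

lemma increments_indep: "indep_vars (\<lambda>_. borel) (\<lambda>(j, s). \<zeta> j s) ({..<N} \<times> {1..})"
  using sech_increments by (simp add: sech_increments_def)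

lemma increment_distributed:
  "j < N \<Longrightarrow> 1 \<le> s \<Longrightarrow> distributed M' lborel (\<zeta> j s) (\<lambda>x. ennreal (1 / (2 * cosh (pi * x / 2))))"
  using sech_increments by (simp add: sech_increments_def)

lemma increment_measurable: "j < N \<Longrightarrow> 1 \<le> s \<Longrightarrow> \<zeta> j s \<in> borel_measurable M'"
  using increment_distributed[of j s] by (auto simp: distributed_def)

lemma imag_walk_measurable: "j < N \<Longrightarrow> imag_walk \<zeta> j t \<in> borel_measurable M'"
  unfolding imag_walk_def[abs_def] by (intro borel_measurable_sum increment_measurable) auto

lemma all_moments_increment:
  assumes "j < N" "1 \<le> s"
  shows "all_moments M' (\<lambda>\<omega>. complex_of_real (\<zeta> j s \<omega>))"
proof -
  have "integrable M' (\<lambda>\<omega>. \<bar>\<zeta> j s \<omega>\<bar> ^ n)" for n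
    using sech_moment_integrable[of n]
    by (subst distributed_integrable[OF increment_distributed[OF assms], symmetric])
       (auto simp: cosh_real_nonneg)
  then show ?thesis
    using increment_measurable[OF assms] by (simp add: all_moments_def)
qed

lemma all_moments_imag_walk:
  assumes "j < N"
  shows "all_moments M' (\<lambda>\<omega>. complex_of_real (imag_walk \<zeta> j t \<omega>))"
  unfolding imag_walk_def of_real_sum
  using assms by (intro all_moments_sum all_moments_increment) (auto intro: finite_measure_axioms)

text \<open>The gain is that the right-hand side does not mention \<open>j\<close>: all rows have
  the same law, and no convolution power of the density has to be computed.\<close>

lemma distr_imag_walk:
  assumes j: "j < N" and t: "1 \<le> t"
  shows "distr M' borel (imag_walk \<zeta> j t) =
    distr (\<Pi>\<^sub>M s\<in>{1..t}. density lborel (\<lambda>x. ennreal (1 / (2 * cosh (pi * x / 2))))) borel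
      (\<lambda>v. \<Sum>s = 1..t. v s)"
proof -
  let ?D = "density lborel (\<lambda>x. ennreal (1 / (2 * cosh (pi * x / 2))))"
  have "indep_vars (\<lambda>_. borel) (\<zeta> j) {1..t}"
  proof -
    have "indep_vars (\<lambda>_. borel) (\<lambda>(j, s). \<zeta> j s) (Pair j ` {1..t})"
      using j by (intro indep_vars_subset[OF increments_indep]) auto
    from indep_vars_reindex_inj[OF _ this] show ?thesis
      by (simp add: inj_on_def)
  qed
  then have *: "distr M' (\<Pi>\<^sub>M s\<in>{1..t}. borel) (\<lambda>\<omega>. \<lambda>s\<in>{1..t}. \<zeta> j s \<omega>) =
      (\<Pi>\<^sub>M s\<in>{1..t}. distr M' borel (\<zeta> j s))"
    using t j by (subst (asm) indep_vars_iff_distr_eq_PiM') (auto intro: increment_measurable)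
  have "distr M' borel (\<zeta> j s) = ?D" if "1 \<le> s" for s
  proof -
    \<comment> \<open>\<open>distributed\<close> has \<open>lborel\<close> as its target and the
      product formula has \<open>borel\<close>; their measurable sets agree.\<close>
    have "distr M' borel (\<zeta> j s) = distr M' lborel (\<zeta> j s)"
      by (rule distr_cong) auto
    with increment_distributed[OF j that] show ?thesis by (simp add: distributed_def)
  qed
  then have "(\<Pi>\<^sub>M s\<in>{1..t}. distr M' borel (\<zeta> j s)) = (\<Pi>\<^sub>M s\<in>{1..t}. ?D)"
    by (intro PiM_cong) auto
  then have "distr (\<Pi>\<^sub>M s\<in>{1..t}. ?D) borel (\<lambda>v. \<Sum>s = 1..t. v s) =
      distr (distr M' (\<Pi>\<^sub>M s\<in>{1..t}. borel) (\<lambda>\<omega>. \<lambda>s\<in>{1..t}. \<zeta> j s \<omega>)) borel (\<lambda>v. \<Sum>s = 1..t. v s)"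
    using * by simp
  also have "\<dots> = distr M' borel (imag_walk \<zeta> j t)"
    using j by (subst distr_distr)
      (auto intro!: measurable_restrict increment_measurable distr_cong borel_measurable_sum
         measurable_component_singleton simp: imag_walk_def)
  finally show ?thesis by simp
qed

text \<open>Row 0 can stand in for every row, so a single family of averaged polynomials serves the
  whole matrix. Without this the matrix of averages would not factor.\<close>

lemma integral_imag_walk_eq:
  fixes g :: "real \<Rightarrow> complex"
  assumes "j < N" "1 \<le> t" and g: "g \<in> borel_measurable borel"
  shows "(\<integral>\<omega>. g (imag_walk \<zeta> j t \<omega>) \<partial>M') = (\<integral>\<omega>. g (imag_walk \<zeta> 0 t \<omega>) \<partial>M')"
proof -
  have "(\<integral>\<omega>. g (imag_walk \<zeta> j t \<omega>) \<partial>M') = integral\<^sup>L (distr M' borel (imag_walk \<zeta> j t)) g" if "j < N" for j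
    using g imag_walk_measurable[OF that] by (simp add: integral_distr)
  then show ?thesis
    using assms distr_imag_walk[of j t] distr_imag_walk[of 0 t] by simp
qed

text \<open>The rows are sums over the disjoint blocks \<open>{j} \<times> {1..t}\<close> of one
  independent family.\<close>

lemma imag_walk_indep: "indep_vars (\<lambda>_. borel) (\<lambda>j. imag_walk \<zeta> j t) {..<N}"
proof -
  have "indep_vars (\<lambda>j. \<Pi>\<^sub>M i\<in>{j} \<times> {1..t}. borel)
      (\<lambda>j \<omega>. restrict (\<lambda>i. (case i of (j, s) \<Rightarrow> \<zeta> j s) \<omega>) ({j} \<times> {1..t})) {..<N}"
    by (rule indep_vars_restrict[OF increments_indep]) (auto simp: disjoint_family_on_def)
  then have "indep_vars (\<lambda>_. borel) (\<lambda>j \<omega>. (\<Sum>s = 1..t.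
      restrict (\<lambda>i. (case i of (j, s) \<Rightarrow> \<zeta> j s) \<omega>) ({j} \<times> {1..t}) (j, s))) {..<N}"
    by (rule indep_vars_compose2) (auto intro!: borel_measurable_sum measurable_component_singleton)
  also have "(\<lambda>j \<omega>. (\<Sum>s = 1..t. restrict (\<lambda>i. (case i of (j, s) \<Rightarrow> \<zeta> j s) \<omega>) ({j} \<times> {1..t}) (j, s))) =
      (\<lambda>j. imag_walk \<zeta> j t)"
    by (auto simp: imag_walk_def fun_eq_iff intro!: sum.cong)
  finally show ?thesis .
qed

end

section \<open>Lagrange polynomials and the determinant of their averages\<close>

lemma Phi_eq_poly:
  "Phi N u k z = poly (\<Prod>j\<in>{..<N} - {k}.
     Polynomial.smult (inverse (of_int (u k) - of_int (u j))) [:- of_int (u j), 1:]) z"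
  by (simp add: Phi_def poly_prod divide_inverse mult.commute del: smult_pCons)

text \<open>A degree below \<open>N\<close> is what makes the coefficient matrix of the
  \<open>N\<close> polynomials square.\<close>

lemma Phi_degree:
  assumes "k < N"
  shows "degree (\<Prod>j\<in>{..<N} - {k}. Polynomial.smult (inverse (of_int (u k) - of_int (u j)))
    [:- of_int (u j), 1:] :: complex poly) < N" (is "degree (prod ?f ?I) < N")
proof -
  have "degree (prod ?f ?I) \<le> (\<Sum>j\<in>?I. degree (?f j))"
    by (rule degree_prod_sum_le[unfolded comp_def]) simp
  also have "\<dots> \<le> (\<Sum>j\<in>?I. 1)"
    by (intro sum_mono) (simp add: degree_smult_le)
  also have "\<dots> < N" using assms by simp
  finally show ?thesis .
qed

lemma Phi_node:
  assumes "inj_on u {..<N}" "j < N" "k < N"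
  shows "Phi N u k (of_int (u j)) = (if j = k then 1 else 0)"
  using assms by (auto simp: Phi_def inj_on_eq_iff intro!: prod.neutral prod_zero)

lemma (in sech_walks) det_mart_eq:
  assumes inj: "inj_on u {..<N}" and t: "1 \<le> t" and N: "1 \<le> N"
  shows "det_mart N u M' \<zeta> t x =
    complex_of_real (vandermonde N (\<lambda>j. real_of_int (x j)) / vandermonde N (\<lambda>j. real_of_int (u j)))"
proof -
  define Y where "Y \<omega> = \<i> * complex_of_real (imag_walk \<zeta> 0 t \<omega>)" for \<omega>
  define P where "P k = (\<Prod>j\<in>{..<N} - {k}.
     Polynomial.smult (inverse (of_int (u k) - of_int (u j))) [:- of_int (u j), 1:] :: complex poly)" for k
  \<comment> \<open>This is the binomial expansion of the mean of \<open>(X + Y)^l\<close> in powers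
    of \<open>X\<close>. The term \<open>i = l\<close> carries the mean of \<open>Y^0\<close>, which
    is 1, so \<open>m l\<close> is monic.\<close>
  define m where "m l = (\<Sum>i\<le>l. Polynomial.monom (of_nat (l choose i) * (\<integral>\<omega>. Y \<omega> ^ (l - i) \<partial>M')) i)" for l
  define C where "C = mat N N (\<lambda>(l, k). coeff (P k) l)"
  define B where "B = mat N N (\<lambda>(j, l). poly (m l) (of_int (x j)))"
  have Phi_P: "Phi N u k z = poly (P k) z" for k z
    unfolding P_def by (rule Phi_eq_poly)
  have C: "C \<in> carrier_mat N N" and B: "B \<in> carrier_mat N N" by (auto simp: C_def B_def)
  have Y: "all_moments M' Y"
    unfolding Y_def using N
    by (intro all_moments_mult all_moments_const all_moments_imag_walk) (auto intro: finite_measure_axioms)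
  have Yn: "integrable M' (\<lambda>\<omega>. Y \<omega> ^ n)" for n
    by (intro all_moments_integrable all_moments_power Y finite_measure_axioms)
  have Yx: "integrable M' (\<lambda>\<omega>. (z + Y \<omega>) ^ n)" for n z
    by (intro all_moments_integrable all_moments_power all_moments_add all_moments_const Y finite_measure_axioms)
  have m_poly: "poly (m l) z = (\<integral>\<omega>. (z + Y \<omega>) ^ l \<partial>M')" for l z
  proof -
    have "(\<integral>\<omega>. (z + Y \<omega>) ^ l \<partial>M') = (\<integral>\<omega>. (\<Sum>i\<le>l. of_nat (l choose i) * z ^ i * Y \<omega> ^ (l - i)) \<partial>M')"
      by (simp add: binomial_ring)
    also have "\<dots> = (\<Sum>i\<le>l. of_nat (l choose i) * z ^ i * (\<integral>\<omega>. Y \<omega> ^ (l - i) \<partial>M'))"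
      using Yn by (subst Bochner_Integration.integral_sum) auto
    also have "\<dots> = poly (m l) z"
      by (simp add: m_def poly_sum poly_monom mult_ac)
    finally show ?thesis by simp
  qed
  have m_coeff: "coeff (m l) i = (if i \<le> l then of_nat (l choose i) * (\<integral>\<omega>. Y \<omega> ^ (l - i) \<partial>M') else 0)" for l i
    by (simp add: m_def coeff_sum)
  have m_lead: "coeff (m l) l = 1" for l
    by (simp add: m_coeff prob_space)
  have m_deg: "degree (m l) = l" for l
    using m_lead by (intro antisym degree_le le_degree) (auto simp: m_coeff)
  have mart: "mart N u M' \<zeta> k j t z = (\<Sum>l<N. coeff (P k) l * poly (m l) (of_int z))"
    if "j < N" "k < N" for j k z
  proof -
    have "mart N u M' \<zeta> k j t z = (\<integral>\<omega>. Phi N u k (of_int z + Y \<omega>) \<partial>M')"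
      unfolding mart_def Y_def using that(1) t
      by (intro integral_imag_walk_eq[where g = "\<lambda>y. Phi N u k (of_int z + \<i> * complex_of_real y)"])
         (auto simp: Phi_def)
    also have "\<dots> = (\<integral>\<omega>. (\<Sum>l<N. coeff (P k) l * (of_int z + Y \<omega>) ^ l) \<partial>M')"
      using poly_eq_sum_lessThan[OF Phi_degree[OF that(2), of u, folded P_def]]
      by (simp add: Phi_P)
    also have "\<dots> = (\<Sum>l<N. coeff (P k) l * poly (m l) (of_int z))"
      using Yx by (subst Bochner_Integration.integral_sum) (auto simp: m_poly)
    finally show ?thesis .
  qed
  have "mat N N (\<lambda>(j, k). mart N u M' \<zeta> k j t (x j)) = B * C"
  proof (rule eq_matI)
    fix j k assume "j < dim_row (B * C)" "k < dim_col (B * C)"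
    then have jk: "j < N" "k < N" by (auto simp: B_def C_def)
    have "mart N u M' \<zeta> k j t (x j) = (\<Sum>l = 0..<N. poly (m l) (of_int (x j)) * coeff (P k) l)"
      using mart[OF jk] by (simp add: mult.commute lessThan_atLeast0)
    with jk show "mat N N (\<lambda>(j, k). mart N u M' \<zeta> k j t (x j)) $$ (j, k) = (B * C) $$ (j, k)"
      by (simp add: B_def C_def scalar_prod_def)
  qed (auto simp: B_def C_def)
  then have "det_mart N u M' \<zeta> t x = Determinant.det B * Determinant.det C"
    using det_mult[OF B C] by (simp add: det_mart_def)
  also have "Determinant.det B = Determinant.det (vandermonde_mat N (\<lambda>j. complex_of_int (x j)))"
    unfolding B_def by (rule det_monic_poly_mat) (auto simp: m_deg m_lead)
  finally have 1: "det_mart N u M' \<zeta> t x =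
      Determinant.det (vandermonde_mat N (\<lambda>j. complex_of_int (x j))) * Determinant.det C" .
  \<comment> \<open>The same coefficient matrix, now evaluated at its own nodes, yields the
    normalising constant without computing any coefficient. That the Vandermonde determinant at
    \<open>u\<close> is nonzero follows too, as the product of the determinants is 1.\<close>
  have "vandermonde_mat N (\<lambda>j. complex_of_int (u j)) * C = mat N N (\<lambda>(j, k). poly (P k) (of_int (u j)))"
    unfolding C_def by (subst poly_mat_eq) (auto simp: Phi_degree P_def simp del: smult_pCons)
  also have "\<dots> = 1\<^sub>m N"
    by (intro eq_matI) (auto simp: Phi_P[symmetric] Phi_node[OF inj])
  finally have "Determinant.det (vandermonde_mat N (\<lambda>j. complex_of_int (u j))) * Determinant.det C = 1"
    using det_mult[OF vandermonde_mat_carrier C, of "\<lambda>j. complex_of_int (u j)"] by simp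
  then have 2: "Determinant.det C = 1 / Determinant.det (vandermonde_mat N (\<lambda>j. complex_of_int (u j)))"
    by (metis mult.commute nonzero_eq_divide_eq mult_zero_left zero_neq_one)
  show ?thesis
    unfolding 1 2 by (simp add: of_real_vandermonde)
qed

subsection \<open>Configurations\<close>

lemma emeasure_unlabel: "emeasure (unlabel N x) A = of_nat (card {j. j < N \<and> x j \<in> A})"
proof -
  have "x -` A \<inter> {..<N} = {j. j < N \<and> x j \<in> A}" by auto
  then show ?thesis
    by (simp add: unlabel_def emeasure_distr emeasure_count_space[of _ "{..<N}"] subset_eq)
qed

lemma sets_unlabel [simp]: "sets (unlabel N x) = sets (count_space UNIV)"
  by (simp add: unlabel_def)

lemma unlabel_in_configs: "unlabel N x \<in> configs"
  by (auto simp: configs_def emeasure_unlabel)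

lemma unlabel_cong:
  assumes "\<And>j. j < N \<Longrightarrow> x j = y j"
  shows "unlabel N x = unlabel N y"
proof (rule measure_eqI)
  fix A show "emeasure (unlabel N x) A = emeasure (unlabel N y) A"
    using assms by (simp add: emeasure_unlabel cong: conj_cong)
qed simp

lemma unlabel_permute:
  assumes "p permutes {..<N}"
  shows "unlabel N (\<lambda>j. x (p j)) = unlabel N x"
proof (rule measure_eqI)
  fix A
  have lt: "p j < N \<longleftrightarrow> j < N" for j
    using permutes_in_image[OF assms, of j] by simp
  have "p ` {j. j < N \<and> x (p j) \<in> A} = {j. j < N \<and> x j \<in> A}"
  proof (intro equalityI subsetI)
    fix j assume j: "j \<in> {j. j < N \<and> x j \<in> A}"
    obtain i where "j = p i" using permutes_surj[OF assms] by (rule surjE)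
    with j show "j \<in> p ` {j. j < N \<and> x (p j) \<in> A}" by (simp add: lt)
  qed (auto simp: lt)
  then have "card {j. j < N \<and> x (p j) \<in> A} = card {j. j < N \<and> x j \<in> A}"
    using card_image[of p "{j. j < N \<and> x (p j) \<in> A}"] permutes_inj[OF assms]
    by (metis inj_on_subset subset_UNIV)
  then show "emeasure (unlabel N (\<lambda>j. x (p j))) A = emeasure (unlabel N x) A"
    by (simp add: emeasure_unlabel)
qed simp

text \<open>The sigma-algebra is generated by evaluations at finite sets, and the number of
  particles in a set is a sum of indicators.\<close>

lemma unlabel_measurable:
  assumes X: "\<And>j. j < N \<Longrightarrow> X j \<in> measurable M (count_space UNIV)"
  shows "(\<lambda>\<omega>. unlabel N (\<lambda>j. X j \<omega>)) \<in> measurable M config_algebra"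
  unfolding config_algebra_def
proof (rule measurable_SUP2)
  fix A :: "int set" assume "A \<in> {A. finite A}"
  have "emeasure (unlabel N (\<lambda>j. X j \<omega>)) A = (\<Sum>j<N. indicator A (X j \<omega>))" for \<omega>
  proof -
    have "(\<Sum>j<N. indicator A (X j \<omega>)) = (\<Sum>j\<in>{j. j < N \<and> X j \<omega> \<in> A}. 1 :: ennreal)"
      by (intro sum.mono_neutral_cong_right) (auto simp: indicator_def)
    then show ?thesis by (simp add: emeasure_unlabel)
  qed
  moreover have "(\<lambda>\<omega>. \<Sum>j<N. indicator A (X j \<omega>) :: ennreal) \<in> borel_measurable M"
    by (intro borel_measurable_sum measurable_compose[OF X]) auto
  ultimately show "(\<lambda>\<omega>. unlabel N (\<lambda>j. X j \<omega>)) \<in> measurable M (vimage_algebra configs (\<lambda>\<eta>. emeasure \<eta> A) borel)"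
    by (intro measurable_vimage_algebra2) (auto simp: unlabel_in_configs)
qed auto

lemma unlabel_path_measurable:
  assumes "\<And>j s. j < N \<Longrightarrow> S j s \<in> measurable M (count_space UNIV)"
  shows "(\<lambda>\<omega>. \<lambda>s\<in>{..t}. unlabel N (\<lambda>j. S j s \<omega>)) \<in> measurable M (path_algebra t)"
  unfolding path_algebra_def using assms by (intro measurable_restrict unlabel_measurable)

text \<open>The defining identity of the noncolliding walk evaluates \<open>h\<close> at the horizon
  of the functional, so a functional up to \<open>t\<close> must be viewed as one up to
  \<open>T\<close>.\<close>

lemma bounded_path_functional_restrict:
  assumes F: "bounded_path_functional t F" and "t \<le> T"
  shows "bounded_path_functional T (\<lambda>\<eta>. F (restrict \<eta> {..t}))"
proof -
  have r: "(\<lambda>\<eta>. restrict \<eta> {..t}) \<in> measurable (path_algebra T) (path_algebra t)"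
    unfolding path_algebra_def using assms(2) by (intro measurable_restrict_subset) auto
  show ?thesis
    using F measurable_compose[OF r, of F borel] measurable_space[OF r]
    unfolding bounded_path_functional_def by blast
qed

subsection \<open>Reflection at the first collision\<close>

definition walk_path :: "(nat \<Rightarrow> int) \<Rightarrow> (nat \<times> nat \<Rightarrow> int) \<Rightarrow> nat \<Rightarrow> nat \<Rightarrow> int" where
  "walk_path u e j s = u j + (\<Sum>r<s. e (j, r))"

definition walk_steps :: "nat \<Rightarrow> nat \<Rightarrow> (nat \<times> nat \<Rightarrow> int) set" where
  "walk_steps N T = ({..<N} \<times> {..<T}) \<rightarrow>\<^sub>E {-1, 1}"

definition outside_chamber :: "nat \<Rightarrow> (nat \<Rightarrow> int) \<Rightarrow> bool" where
  "outside_chamber N x \<longleftrightarrow> (\<exists>j k. j < k \<and> k < N \<and> x k \<le> x j)"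

definition collides :: "nat \<Rightarrow> nat \<Rightarrow> (nat \<Rightarrow> nat \<Rightarrow> int) \<Rightarrow> bool" where
  "collides N T p \<longleftrightarrow> (\<exists>s. 1 \<le> s \<and> s \<le> T \<and> outside_chamber N (\<lambda>j. p j s))"

text \<open>Without a collision the value is unspecified; the facts about it below all assume
  \<open>collides\<close>.\<close>

definition first_collision :: "nat \<Rightarrow> (nat \<Rightarrow> nat \<Rightarrow> int) \<Rightarrow> nat" where
  "first_collision N p = (LEAST s. 1 \<le> s \<and> outside_chamber N (\<lambda>j. p j s))"

text \<open>The pair is chosen as a function of the positions at the collision alone, which makes the
  reflection an involution.\<close>

definition colliding_pair :: "nat \<Rightarrow> (nat \<Rightarrow> int) \<Rightarrow> nat \<times> nat" where
  "colliding_pair N x = (SOME (a, b). a < b \<and> b < N \<and> x a = x b)"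

definition collision_swap :: "nat \<Rightarrow> (nat \<Rightarrow> nat \<Rightarrow> int) \<Rightarrow> nat \<Rightarrow> nat" where
  "collision_swap N p = (case colliding_pair N (\<lambda>i. p i (first_collision N p)) of
     (a, b) \<Rightarrow> Transposition.transpose a b)"

text \<open>The entry \<open>e (i, r)\<close> is the step from time \<open>r\<close> to
  \<open>r + 1\<close>, so the steps with index at least the collision time are those taken after
  the meeting, and the position at the collision itself is untouched. Permuting steps instead of
  positions keeps the result an array of signs.\<close>

definition reflect :: "nat \<Rightarrow> (nat \<Rightarrow> int) \<Rightarrow> (nat \<times> nat \<Rightarrow> int) \<Rightarrow> nat \<times> nat \<Rightarrow> int" where
  "reflect N u e = (\<lambda>(i, r). if first_collision N (walk_path u e) \<le> r
     then e (collision_swap N (walk_path u e) i, r) else e (i, r))"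

lemma finite_walk_steps: "finite (walk_steps N T)"
  unfolding walk_steps_def by (intro finite_PiE) auto

lemma walk_path_Suc: "walk_path u e j (Suc s) = walk_path u e j s + e (j, s)"
  by (simp add: walk_path_def)

lemma outside_chamber_iff: "outside_chamber N x \<longleftrightarrow> (\<lambda>j. real_of_int (x j)) \<notin> weyl_chamber N"
  by (auto simp: outside_chamber_def weyl_chamber_def not_less)

text \<open>A strict bound survives the infimum because a nonempty set of extended naturals attains
  it, while the empty set has infimum infinity.\<close>

lemma less_collision_time_iff:
  "enat T < collision_time N S \<omega> \<longleftrightarrow> \<not> collides N T (\<lambda>j s. S j s \<omega>)"
proof -
  let ?A = "{t. 1 \<le> t \<and> (\<lambda>j. real_of_int (S j t \<omega>)) \<notin> weyl_chamber N}"
  have "enat T < Inf (enat ` ?A) \<longleftrightarrow> (\<forall>a\<in>enat ` ?A. enat T < a)"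
  proof
    assume "enat T < Inf (enat ` ?A)"
    then show "\<forall>a\<in>enat ` ?A. enat T < a"
      by (meson Inf_lower order.strict_trans2)
  next
    assume *: "\<forall>a\<in>enat ` ?A. enat T < a"
    show "enat T < Inf (enat ` ?A)"
    proof (cases "enat ` ?A = {}")
      case True
      then show ?thesis by (simp only: Inf_empty) (simp add: top_enat_def)
    next
      case False
      then have "Inf (enat ` ?A) \<in> enat ` ?A"
        by (meson all_not_in_conv wellorder_InfI)
      with * show ?thesis by blast
    qed
  qed
  then show ?thesis
    unfolding collision_time_def collides_def outside_chamber_iff by (auto simp: not_less)
qed

locale even_start =
  fixes N T :: nat and u :: "nat \<Rightarrow> int"
  assumes mono: "strict_mono_on {..<N} u" and even: "\<And>j. j < N \<Longrightarrow> even (u j)"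
begin

lemma step_cases:
  assumes "e \<in> walk_steps N T" "j < N" "r < T"
  shows "e (j, r) = -1 \<or> e (j, r) = 1"
  using PiE_mem[OF assms(1)[unfolded walk_steps_def], of "(j, r)"] assms by auto

text \<open>Every step is odd, so position and time change parity together; the even start puts all
  particles in the same class at each time.\<close>

lemma walk_path_parity:
  assumes "e \<in> walk_steps N T" "j < N" "s \<le> T"
  shows "even (walk_path u e j s - int s)"
  using assms(3)
proof (induction s)
  case 0
  then show ?case using even assms by (simp add: walk_path_def)
next
  case (Suc s)
  then have "even (walk_path u e j s - int s)" by simp
  moreover have "e (j, s) = -1 \<or> e (j, s) = 1"
    using step_cases assms Suc.prems by simp
  ultimately show ?case by (auto simp: walk_path_Suc)
qed

section \<open>The reflection of a single colliding path\<close>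

context
  fixes e p \<tau> \<sigma>
  assumes e: "e \<in> walk_steps N T" and coll: "collides N T (walk_path u e)"
  defines "p \<equiv> walk_path u e" and "\<tau> \<equiv> first_collision N p" and "\<sigma> \<equiv> collision_swap N p"
begin

lemma first_collision_bounds: "1 \<le> \<tau>" "\<tau> \<le> T"
  and first_collision_outside: "outside_chamber N (\<lambda>j. p j \<tau>)"
  and first_collision_min: "1 \<le> s \<Longrightarrow> outside_chamber N (\<lambda>j. p j s) \<Longrightarrow> \<tau> \<le> s"
proof -
  obtain s where s: "1 \<le> s" "s \<le> T" "outside_chamber N (\<lambda>j. p j s)"
    using coll by (auto simp: collides_def p_def)
  from LeastI[of "\<lambda>s. 1 \<le> s \<and> outside_chamber N (\<lambda>j. p j s)" s] s
  show "1 \<le> \<tau>" "outside_chamber N (\<lambda>j. p j \<tau>)"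
    by (auto simp: \<tau>_def first_collision_def)
  show *: "\<tau> \<le> s" if "1 \<le> s" "outside_chamber N (\<lambda>j. p j s)" for s
    using that by (auto simp: \<tau>_def first_collision_def intro: Least_le)
  show "\<tau> \<le> T" using *[of s] s by simp
qed

text \<open>Ordered particles of equal parity are at distance at least 2, so one step cannot make
  them cross without meeting.\<close>

lemma collision_meeting: "\<exists>a b. a < b \<and> b < N \<and> p a \<tau> = p b \<tau>"
proof -
  obtain a b where ab: "a < b" "b < N" "p b \<tau> \<le> p a \<tau>"
    using first_collision_outside by (auto simp: outside_chamber_def)
  obtain s where s: "\<tau> = Suc s" using first_collision_bounds by (cases \<tau>) auto
  have "p a s < p b s"
  \<comment> \<open>Collisions are counted from time 1 on, so the order at time 0 has to come from
    the starting points.\<close>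
  proof (cases "s = 0")
    case True
    then show ?thesis
      using strict_mono_onD[OF mono, of a b] ab by (simp add: p_def walk_path_def)
  next
    case False
    then have "\<not> outside_chamber N (\<lambda>j. p j s)"
      using first_collision_min[of s] s by auto
    then show ?thesis using ab by (auto simp: outside_chamber_def not_le)
  qed
  moreover have "even (p b s - p a s)"
  proof -
    have "p b s - p a s = (p b s - int s) - (p a s - int s)" by simp
    then show ?thesis
      using walk_path_parity[OF e, of a s] walk_path_parity[OF e, of b s] ab s first_collision_bounds
      unfolding p_def by (metis Suc_leD dvd_diff order.strict_trans)
  qed
  ultimately have "p a s + 2 \<le> p b s" by presburger
  moreover have "p a \<tau> = p a s + e (a, s)" "p b \<tau> = p b s + e (b, s)"
    by (auto simp: s p_def walk_path_Suc)
  moreover have "e (a, s) = -1 \<or> e (a, s) = 1" "e (b, s) = -1 \<or> e (b, s) = 1"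
    using step_cases[OF e, of a s] step_cases[OF e, of b s] ab s first_collision_bounds by auto
  ultimately have "p a \<tau> = p b \<tau>" using ab by linarith
  then show ?thesis using ab by blast
qed

lemma collision_swap_transpose:
  obtains a b where "\<sigma> = Transposition.transpose a b" "a < b" "b < N" "p a \<tau> = p b \<tau>"
proof -
  obtain a b where ab: "colliding_pair N (\<lambda>i. p i \<tau>) = (a, b)" by fastforce
  have "case colliding_pair N (\<lambda>i. p i \<tau>) of (a, b) \<Rightarrow> a < b \<and> b < N \<and> p a \<tau> = p b \<tau>"
    unfolding colliding_pair_def using collision_meeting by (intro someI_ex[of "\<lambda>(a, b). a < b \<and> b < N \<and> p a \<tau> = p b \<tau>"]) auto
  with ab that show thesis by (auto simp: \<sigma>_def collision_swap_def \<tau>_def)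
qed

lemma reflect_apply: "reflect N u e (i, r) = (if \<tau> \<le> r then e (\<sigma> i, r) else e (i, r))"
  by (simp add: reflect_def p_def \<tau>_def \<sigma>_def)

lemma reflect_walk_steps: "reflect N u e \<in> walk_steps N T"
proof -
  obtain a b where ab: "\<sigma> = Transposition.transpose a b" "a < b" "b < N"
    using collision_swap_transpose by metis
  have lt: "\<sigma> i < N \<longleftrightarrow> i < N" for i
    using ab by (auto simp: Transposition.transpose_def)
  show ?thesis
    using e unfolding walk_steps_def
    by (auto simp: PiE_iff extensional_def reflect_apply lt)
qed

lemma reflect_path_before:
  assumes "s \<le> \<tau>"
  shows "walk_path u (reflect N u e) i s = p i s"
  using assms by (auto simp: walk_path_def p_def reflect_apply intro!: sum.cong)

text \<open>True at the collision because the two exchanged particles sit at the same point; from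
  then on both sides make the same steps.\<close>

lemma reflect_path_after:
  assumes "\<tau> \<le> s"
  shows "walk_path u (reflect N u e) i s = p (\<sigma> i) s"
  using assms
proof (induction s rule: dec_induct)
  case base
  obtain a b where ab: "\<sigma> = Transposition.transpose a b" "p a \<tau> = p b \<tau>"
    using collision_swap_transpose by metis
  then show ?case by (auto simp: reflect_path_before Transposition.transpose_def)
next
  case (step s)
  then show ?case by (simp add: walk_path_Suc p_def reflect_apply)
qed

lemma reflect_first_collision: "first_collision N (walk_path u (reflect N u e)) = \<tau>"
  unfolding first_collision_def
proof (rule Least_equality)
  show "1 \<le> \<tau> \<and> outside_chamber N (\<lambda>j. walk_path u (reflect N u e) j \<tau>)"
    using first_collision_bounds first_collision_outside by (simp add: reflect_path_before)
next
  fix s assume "1 \<le> s \<and> outside_chamber N (\<lambda>j. walk_path u (reflect N u e) j s)"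
  then show "\<tau> \<le> s"
    using first_collision_min[of s] by (cases "s \<le> \<tau>") (auto simp: reflect_path_before)
qed

lemma reflect_collides: "collides N T (walk_path u (reflect N u e))"
  using first_collision_bounds first_collision_outside
  by (auto simp: collides_def reflect_path_before intro!: exI[of _ \<tau>])

text \<open>The reflected path agrees with the original up to and including the collision. It
  therefore has the same collision time and the same chosen pair, and the second exchange undoes the
  first.\<close>

lemma reflect_reflect: "reflect N u (reflect N u e) = e"
proof -
  have "collision_swap N (walk_path u (reflect N u e)) = \<sigma>"
    unfolding \<sigma>_def collision_swap_def reflect_first_collision
    by (simp add: reflect_path_before flip: \<tau>_def)
  moreover have "\<sigma> (\<sigma> i) = i" for i
    using collision_swap_transpose by (metis transpose_involutory)
  ultimately have "reflect N u (reflect N u e) (i, r) = e (i, r)" for i r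
    unfolding reflect_def[of N u "reflect N u e"] reflect_first_collision
    by (simp add: reflect_apply)
  then show ?thesis by auto
qed

lemma reflect_unlabel: "unlabel N (\<lambda>j. walk_path u (reflect N u e) j s) = unlabel N (\<lambda>j. p j s)"
proof (cases "s \<le> \<tau>")
  case True
  then show ?thesis by (simp add: reflect_path_before)
next
  case False
  obtain a b where "\<sigma> = Transposition.transpose a b" "a < b" "b < N"
    using collision_swap_transpose by metis
  then have "\<sigma> permutes {..<N}" by (auto intro: permutes_swap_id)
  from unlabel_permute[OF this, of "\<lambda>j. p j s"] False show ?thesis
    by (simp add: reflect_path_after)
qed

lemma reflect_vandermonde:
  "vandermonde N (\<lambda>j. real_of_int (walk_path u (reflect N u e) j T)) =
     - vandermonde N (\<lambda>j. real_of_int (p j T))"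
proof -
  obtain a b where ab: "\<sigma> = Transposition.transpose a b" "a < b" "b < N"
    using collision_swap_transpose by metis
  then show ?thesis
    using vandermonde_swap[of a N b "\<lambda>j. real_of_int (p j T)"] first_collision_bounds
    by (simp add: reflect_path_after)
qed

end

lemma sum_collides_vandermonde_eq_0:
  "(\<Sum>e\<in>walk_steps N T. F (\<lambda>s\<in>{..t}. unlabel N (\<lambda>j. walk_path u e j s))
      * of_bool (collides N T (walk_path u e))
      * vandermonde N (\<lambda>j. real_of_int (walk_path u e j T))) = (0 :: real)"
proof -
  let ?A = "{e \<in> walk_steps N T. collides N T (walk_path u e)}"
  let ?g = "\<lambda>e. F (\<lambda>s\<in>{..t}. unlabel N (\<lambda>j. walk_path u e j s))
      * vandermonde N (\<lambda>j. real_of_int (walk_path u e j T))"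
  \<comment> \<open>Being its own inverse, the reflection permutes the finite set of colliding
    arrays, so the total over this set equals its own negative.\<close>
  have "bij_betw (reflect N u) ?A ?A"
    by (rule bij_betw_byWitness[where f' = "reflect N u"])
       (auto simp: reflect_reflect reflect_collides reflect_walk_steps)
  then have "(\<Sum>e\<in>?A. ?g e) = (\<Sum>e\<in>?A. ?g (reflect N u e))"
    by (rule sum.reindex_bij_betw[symmetric])
  also have "\<dots> = (\<Sum>e\<in>?A. - ?g e)"
    by (intro sum.cong) (auto simp: reflect_unlabel reflect_vandermonde)
  finally have "(\<Sum>e\<in>?A. ?g e) = 0" by (simp add: sum_negf)
  moreover have "(\<Sum>e\<in>walk_steps N T. ?g e * of_bool (collides N T (walk_path u e))) = (\<Sum>e\<in>?A. ?g e)"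
    by (intro sum.mono_neutral_cong_right finite_walk_steps) auto
  ultimately show ?thesis by (simp add: mult_ac)
qed

end

subsection \<open>The law of the increments\<close>

text \<open>With both labels ranging over an explicit finite set, congruence and measurability can
  be checked label by label.\<close>

lemma outside_chamber_Bex:
  "outside_chamber N x \<longleftrightarrow> (\<exists>j\<in>{..<N}. \<exists>k\<in>{..<N}. j < k \<and> x k \<le> x j)"
  unfolding outside_chamber_def by (meson lessThan_iff order.strict_trans)

lemma outside_chamber_cong:
  assumes "\<And>j. j < N \<Longrightarrow> x j = y j"
  shows "outside_chamber N x = outside_chamber N y"
  unfolding outside_chamber_Bex using assms by simp

locale indep_walks = even_start N T u
  for N T :: nat and u :: "nat \<Rightarrow> int" +
  fixes M :: "'a measure" and S :: "nat \<Rightarrow> nat \<Rightarrow> 'a \<Rightarrow> int"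
  assumes walks: "independent_walks N u M S" and N: "1 \<le> N" and T: "1 \<le> T"
begin

sublocale prob_space M
  using walks by (simp add: independent_walks_def)

lemma labels_nonempty: "{..<N} \<noteq> {}" and times_nonempty: "{..<T} \<noteq> {}"
  using N T by (auto simp: lessThan_empty_iff)

text \<open>Restricted to the relevant indices so that the array is extensional, as the members of
  \<open>walk_steps\<close> are.\<close>

definition increments :: "'a \<Rightarrow> nat \<times> nat \<Rightarrow> int" where
  "increments \<omega> = (\<lambda>(j, r)\<in>{..<N} \<times> {..<T}. S j (Suc r) \<omega> - S j r \<omega>)"

lemma walk_simple: "j < N \<Longrightarrow> simple_symmetric_walk M (u j) (S j)"
  using walks by (simp add: independent_walks_def)

lemma walk_measurable: "j < N \<Longrightarrow> S j s \<in> measurable M (count_space UNIV)"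
  using walk_simple by (simp add: simple_symmetric_walk_def)

lemma increment_measurable:
  "j < N \<Longrightarrow> (\<lambda>\<omega>. S j (Suc r) \<omega> - S j r \<omega>) \<in> measurable M (count_space UNIV)"
  using walk_simple[of j] by (auto simp: simple_symmetric_walk_def indep_vars_def2)

lemma increment_distr:
  "j < N \<Longrightarrow> distr M (count_space UNIV) (\<lambda>\<omega>. S j (Suc r) \<omega> - S j r \<omega>) = measure_pmf (pmf_of_set {-1, 1})"
  using walk_simple[of j] by (simp add: simple_symmetric_walk_def)

lemma AE_increments: "AE \<omega> in M. increments \<omega> \<in> walk_steps N T"
proof -
  have "AE \<omega> in M. S j (Suc r) \<omega> - S j r \<omega> \<in> {-1, 1}" if "j < N" for j r
  proof (rule AE_distrD[OF increment_measurable[OF that]])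
    have "AE x in measure_pmf (pmf_of_set {-1, 1 :: int}). x \<in> set_pmf (pmf_of_set {-1, 1})"
      by (rule AE_pmfI)
    then show "AE x in distr M (count_space UNIV) (\<lambda>\<omega>. S j (Suc r) \<omega> - S j r \<omega>). x \<in> {-1, 1}"
      unfolding increment_distr[OF that] by simp
  qed
  then have "AE \<omega> in M. \<forall>jr\<in>{..<N} \<times> {..<T}. S (fst jr) (Suc (snd jr)) \<omega> - S (fst jr) (snd jr) \<omega> \<in> {-1, 1}"
    by (intro AE_finite_allI) auto
  then show ?thesis
    by eventually_elim (force simp: walk_steps_def increments_def)
qed

text \<open>A telescoping sum. It holds almost everywhere because the starting point is itself
  prescribed up to a null set.\<close>

lemma AE_walk_path: "AE \<omega> in M. \<forall>j<N. \<forall>s\<le>T. S j s \<omega> = walk_path u (increments \<omega>) j s"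
proof -
  have "AE \<omega> in M. \<forall>j\<in>{..<N}. S j 0 \<omega> = u j"
    using walk_simple by (intro AE_finite_allI) (auto simp: simple_symmetric_walk_def)
  then show ?thesis
  proof eventually_elim
    case (elim \<omega>)
    have "walk_path u (increments \<omega>) j s = S j s \<omega>" if "j < N" "s \<le> T" for j s
    proof -
      have "(\<Sum>r<s. increments \<omega> (j, r)) = (\<Sum>r<s. S j (Suc r) \<omega> - S j r \<omega>)"
        using that by (intro sum.cong) (auto simp: increments_def)
      then show ?thesis
        using elim that sum_lessThan_telescope[of "\<lambda>r. S j r \<omega>" s] by (simp add: walk_path_def)
    qed
    then show ?case by simp
  qed
qed

definition steps_event :: "(nat \<times> nat \<Rightarrow> int) \<Rightarrow> 'a set" where
  "steps_event e = {\<omega> \<in> space M. \<forall>j<N. \<forall>r<T. S j (Suc r) \<omega> - S j r \<omega> = e (j, r)}"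

lemma steps_event_eq:
  "steps_event e = (\<Inter>j\<in>{..<N}. \<Inter>r\<in>{..<T}. (\<lambda>\<omega>. S j (Suc r) \<omega> - S j r \<omega>) -` {e (j, r)} \<inter> space M)"
  using N T by (auto simp: steps_event_def Suc_le_eq)

lemma steps_event_sets: "steps_event e \<in> events"
  unfolding steps_event_eq using labels_nonempty times_nonempty
  by (intro sets.finite_INT measurable_sets[OF increment_measurable]) auto

lemma steps_event_iff:
  assumes "e \<in> walk_steps N T" "\<omega> \<in> space M"
  shows "\<omega> \<in> steps_event e \<longleftrightarrow> increments \<omega> = e"
proof
  assume "\<omega> \<in> steps_event e"
  then show "increments \<omega> = e"
    using assms by (auto simp: steps_event_def increments_def walk_steps_def PiE_def extensional_def fun_eq_iff)
next
  assume "increments \<omega> = e"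
  then show "\<omega> \<in> steps_event e"
    using assms by (auto simp: steps_event_def increments_def)
qed

text \<open>Independence enters at two levels: between the whole trajectories of different
  particles, whence the sets \<open>A j\<close> of trajectories, and between the increments within
  one trajectory.\<close>

lemma prob_steps_event:
  assumes e: "e \<in> walk_steps N T"
  shows "prob (steps_event e) = (1 / 2) ^ (N * T)"
proof -
  let ?D = "\<lambda>j r \<omega>. S j (Suc r) \<omega> - S j r \<omega>"
  let ?X = "\<lambda>j \<omega> t. S j t \<omega>"
  define A where "A j = {p. \<forall>r<T. p (Suc r) - p r = e (j, r)}" for j
  have A: "A j \<in> sets (\<Pi>\<^sub>M t\<in>UNIV. count_space UNIV)" for j
  proof -
    have "{p \<in> space (\<Pi>\<^sub>M t\<in>(UNIV :: nat set). count_space (UNIV :: int set)). \<forall>r<T. p (Suc r) - p r = e (j, r)}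
        \<in> sets (\<Pi>\<^sub>M t\<in>UNIV. count_space UNIV)"
      by measurable
    then show ?thesis by (simp add: A_def space_PiM)
  qed
  have row: "?X j -` A j \<inter> space M = (\<Inter>r\<in>{..<T}. ?D j r -` {e (j, r)} \<inter> space M)" for j
    using T by (auto simp: A_def Suc_le_eq)
  have prob_step: "prob (?D j r -` {e (j, r)} \<inter> space M) = 1 / 2" if "j < N" "r < T" for j r
  proof -
    have "prob (?D j r -` {e (j, r)} \<inter> space M) = measure (distr M (count_space UNIV) (?D j r)) {e (j, r)}"
      using increment_measurable[OF that(1)] by (simp add: measure_distr)
    also have "\<dots> = pmf (pmf_of_set {-1, 1}) (e (j, r))"
      using that by (simp add: increment_distr measure_pmf_single)
    also have "\<dots> = 1 / 2"
      using step_cases[OF e that] by (auto simp: pmf_of_set)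
    finally show ?thesis .
  qed
  have prob_row: "prob (?X j -` A j \<inter> space M) = (1 / 2) ^ T" if "j < N" for j
  proof -
    have "indep_vars (\<lambda>_. count_space UNIV) (?D j) UNIV"
      using walk_simple[OF that] by (simp add: simple_symmetric_walk_def)
    then have "prob (\<Inter>r\<in>{..<T}. ?D j r -` {e (j, r)} \<inter> space M) =
        (\<Prod>r<T. prob (?D j r -` {e (j, r)} \<inter> space M))"
      using times_nonempty by (intro indep_varsD[where A = "\<lambda>r. {e (j, r)}"]) auto
    also have "\<dots> = (\<Prod>r<T. 1 / 2)"
      using that by (intro prod.cong prob_step) auto
    also have "\<dots> = (1 / 2) ^ T"
      by (simp only: prod_constant card_lessThan)
    finally show ?thesis by (simp only: row)
  qed
  have "indep_vars (\<lambda>_. \<Pi>\<^sub>M t\<in>UNIV. count_space UNIV) ?X {..<N}"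
    using walks by (simp add: independent_walks_def)
  then have "prob (\<Inter>j\<in>{..<N}. ?X j -` A j \<inter> space M) = (\<Prod>j<N. prob (?X j -` A j \<inter> space M))"
    using labels_nonempty A by (intro indep_varsD[where A = A]) auto
  also have "\<dots> = (\<Prod>j<N. (1 / 2) ^ T)"
    by (intro prod.cong prob_row) auto
  also have "\<dots> = (1 / 2) ^ (N * T)"
    by (simp only: prod_constant card_lessThan power_mult mult.commute[of N])
  finally show ?thesis by (simp only: steps_event_eq row INT_simps)
qed

text \<open>Since all sign arrays have equal probability, the expectation becomes an unweighted
  finite sum, in which a bijection of arrays acts as a change of variables.\<close>

lemma expectation_increments:
  fixes f :: "'a \<Rightarrow> real"
  assumes f: "f \<in> borel_measurable M" and g: "AE \<omega> in M. f \<omega> = g (increments \<omega>)"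
  shows "expectation f = (\<Sum>e\<in>walk_steps N T. g e) * (1 / 2) ^ (N * T)"
proof -
  have "expectation f = expectation (\<lambda>\<omega>. \<Sum>e\<in>walk_steps N T. g e * indicator (steps_event e) \<omega>)"
  proof (rule integral_cong_AE)
    show "AE \<omega> in M. f \<omega> = (\<Sum>e\<in>walk_steps N T. g e * indicator (steps_event e) \<omega>)"
      using g AE_increments AE_space
    proof eventually_elim
      case (elim \<omega>)
      have "(\<Sum>e\<in>walk_steps N T. g e * indicator (steps_event e) \<omega>) =
          (\<Sum>e\<in>walk_steps N T. if increments \<omega> = e then g e else 0)"
        using elim by (intro sum.cong) (auto simp: steps_event_iff indicator_def)
      also have "\<dots> = g (increments \<omega>)"
        using elim finite_walk_steps by (simp add: sum.delta')
      finally show ?case using elim by simp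
    qed
  qed (use f steps_event_sets in auto)
  also have "\<dots> = (\<Sum>e\<in>walk_steps N T. g e * prob (steps_event e))"
    using steps_event_sets by (subst Bochner_Integration.integral_sum) (auto simp: emeasure_eq_measure)
  also have "\<dots> = (\<Sum>e\<in>walk_steps N T. g e) * (1 / 2) ^ (N * T)"
    by (simp add: prob_steps_event sum_distrib_right)
  finally show ?thesis .
qed

lemma functional_measurable:
  assumes "bounded_path_functional t F"
  shows "(\<lambda>\<omega>. F (\<lambda>s\<in>{..t}. unlabel N (\<lambda>j. S j s \<omega>))) \<in> borel_measurable M"
  using assms unfolding bounded_path_functional_def
  by (intro measurable_compose[OF unlabel_path_measurable]) (auto intro: walk_measurable)

lemma vandermonde_walk_measurable:
  "(\<lambda>\<omega>. vandermonde N (\<lambda>j. real_of_int (S j s \<omega>))) \<in> borel_measurable M"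
  unfolding vandermonde_def
  by (intro borel_measurable_prod borel_measurable_diff measurable_compose[OF walk_measurable]) auto

lemma collides_measurable:
  "(\<lambda>\<omega>. of_bool (collides N s (\<lambda>j r. S j r \<omega>)) :: real) \<in> borel_measurable M"
proof -
  have iff: "collides N s (\<lambda>j r. S j r \<omega>) \<longleftrightarrow>
      (\<exists>r\<in>{1..s}. \<exists>j\<in>{..<N}. \<exists>k\<in>{..<N}. j < k \<and> S k r \<omega> \<le> S j r \<omega>)" for \<omega>
    unfolding collides_def outside_chamber_Bex by (simp only: Bex_def atLeastAtMost_iff conj_assoc)
  have [measurable]: "Measurable.pred M (\<lambda>\<omega>. collides N s (\<lambda>j r. S j r \<omega>))"
    unfolding iff
  proof (rule pred_intros_finite(4), simp, rule pred_intros_finite(4), simp, rule pred_intros_finite(4), simp)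
    fix r j k assume "j \<in> {..<N}" "k \<in> {..<N}"
    then have [measurable]: "S j r \<in> measurable M (count_space UNIV)" "S k r \<in> measurable M (count_space UNIV)"
      by (auto intro: walk_measurable)
    show "Measurable.pred M (\<lambda>\<omega>. j < k \<and> S k r \<omega> \<le> S j r \<omega>)" by measurable
  qed
  show ?thesis by measurable
qed

text \<open>Carries the cancellation over sign arrays back to the walks; by \<open>t \<le> T\<close>
  the argument of \<open>F\<close> can be read off from the first \<open>T\<close>
  increments.\<close>

lemma expectation_collides_vandermonde_eq_0:
  assumes F: "bounded_path_functional t F" and t: "t \<le> T"
  shows "expectation (\<lambda>\<omega>. F (\<lambda>s\<in>{..t}. unlabel N (\<lambda>j. S j s \<omega>))
      * of_bool (collides N T (\<lambda>j s. S j s \<omega>)) * vandermonde N (\<lambda>j. real_of_int (S j T \<omega>))) = 0"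
proof -
  have "AE \<omega> in M. F (\<lambda>s\<in>{..t}. unlabel N (\<lambda>j. S j s \<omega>))
      * of_bool (collides N T (\<lambda>j s. S j s \<omega>)) * vandermonde N (\<lambda>j. real_of_int (S j T \<omega>)) =
    F (\<lambda>s\<in>{..t}. unlabel N (\<lambda>j. walk_path u (increments \<omega>) j s))
      * of_bool (collides N T (walk_path u (increments \<omega>)))
      * vandermonde N (\<lambda>j. real_of_int (walk_path u (increments \<omega>) j T))"
    using AE_walk_path
  proof eventually_elim
    case (elim \<omega>)
    let ?p = "walk_path u (increments \<omega>)"
    have "(\<lambda>s\<in>{..t}. unlabel N (\<lambda>j. S j s \<omega>)) = (\<lambda>s\<in>{..t}. unlabel N (\<lambda>j. ?p j s))"
      using elim t by (intro restrict_ext unlabel_cong) auto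
    moreover have "outside_chamber N (\<lambda>j. S j s \<omega>) \<longleftrightarrow> outside_chamber N (\<lambda>j. ?p j s)" if "s \<le> T" for s
      using elim that by (intro outside_chamber_cong) auto
    then have "collides N T (\<lambda>j s. S j s \<omega>) \<longleftrightarrow> collides N T ?p"
      unfolding collides_def by (auto cong: conj_cong)
    moreover have "vandermonde N (\<lambda>j. real_of_int (S j T \<omega>)) = vandermonde N (\<lambda>j. real_of_int (?p j T))"
      unfolding vandermonde_def using elim by (intro prod.cong) auto
    ultimately show ?case by simp
  qed
  then have "expectation (\<lambda>\<omega>. F (\<lambda>s\<in>{..t}. unlabel N (\<lambda>j. S j s \<omega>))
      * of_bool (collides N T (\<lambda>j s. S j s \<omega>)) * vandermonde N (\<lambda>j. real_of_int (S j T \<omega>))) =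
    (\<Sum>e\<in>walk_steps N T. F (\<lambda>s\<in>{..t}. unlabel N (\<lambda>j. walk_path u e j s))
      * of_bool (collides N T (walk_path u e))
      * vandermonde N (\<lambda>j. real_of_int (walk_path u e j T))) * (1 / 2) ^ (N * T)"
    by (intro expectation_increments[where g = "\<lambda>e. F (\<lambda>s\<in>{..t}. unlabel N (\<lambda>j. walk_path u e j s))
      * of_bool (collides N T (walk_path u e)) * vandermonde N (\<lambda>j. real_of_int (walk_path u e j T))"]
      borel_measurable_times functional_measurable[OF F] vandermonde_walk_measurable collides_measurable)
  then show ?thesis by (simp add: sum_collides_vandermonde_eq_0)
qed

section \<open>Moments of the walks, the functional and the Vandermonde product\<close>

lemma AE_walk_bounded:
  assumes j: "j < N"
  shows "AE \<omega> in M. norm (complex_of_int (S j T \<omega>)) \<le> \<bar>real_of_int (u j)\<bar> + T"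
  using AE_walk_path AE_increments
proof eventually_elim
  case (elim \<omega>)
  have "\<bar>\<Sum>r<T. increments \<omega> (j, r)\<bar> \<le> (\<Sum>r<T. \<bar>increments \<omega> (j, r)\<bar>)"
    by (rule sum_abs)
  also have "\<dots> \<le> (\<Sum>r<T. 1)"
    using step_cases[OF elim(2) j] by (intro sum_mono) (metis abs_1 abs_minus_cancel lessThan_iff order_refl)
  finally have "\<bar>S j T \<omega>\<bar> \<le> \<bar>u j\<bar> + int T"
    using elim(1) j by (auto simp: walk_path_def)
  then have "real_of_int \<bar>S j T \<omega>\<bar> \<le> real_of_int (\<bar>u j\<bar> + int T)"
    by (simp only: of_int_le_iff)
  then show ?case by simp
qed

lemma all_moments_walk: "j < N \<Longrightarrow> all_moments M (\<lambda>\<omega>. complex_of_int (S j T \<omega>))"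
  by (intro all_moments_AE_bounded[OF finite_measure_axioms _ AE_walk_bounded]
      measurable_compose[OF walk_measurable]) auto

lemma all_moments_functional:
  assumes F: "bounded_path_functional t F"
  shows "all_moments M (\<lambda>\<omega>. complex_of_real (F (\<lambda>s\<in>{..t}. unlabel N (\<lambda>j. S j s \<omega>))))"
proof -
  obtain B where B: "\<And>\<eta>. \<eta> \<in> space (path_algebra t) \<Longrightarrow> \<bar>F \<eta>\<bar> \<le> B"
    using F by (auto simp: bounded_path_functional_def)
  show ?thesis
  proof (rule all_moments_AE_bounded[where B = B])
    show "AE \<omega> in M. norm (complex_of_real (F (\<lambda>s\<in>{..t}. unlabel N (\<lambda>j. S j s \<omega>)))) \<le> B"
      using measurable_space[OF unlabel_path_measurable[of N S M t, OF walk_measurable]] B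
      by (intro AE_I2) simp
  qed (use functional_measurable[OF F] finite_measure_axioms in auto)
qed

lemma all_moments_vandermonde: "all_moments M (\<lambda>\<omega>. complex_of_real (vandermonde N (\<lambda>j. real_of_int (S j T \<omega>))))"
proof -
  have diff: "all_moments M (\<lambda>\<omega>. complex_of_int (S k T \<omega>) + (-1) * complex_of_int (S j T \<omega>))"
    if "j < N" "k < N" for j k
    by (rule all_moments_add[OF all_moments_walk[OF that(2)]
        all_moments_mult[OF all_moments_const[OF finite_measure_axioms] all_moments_walk[OF that(1)]]])
  have "all_moments M (\<lambda>\<omega>. \<Prod>k<N. \<Prod>j<k. complex_of_int (S k T \<omega>) + (-1) * complex_of_int (S j T \<omega>))"
    by (intro all_moments_prod[OF finite_measure_axioms] diff) auto
  also have "(\<lambda>\<omega>. \<Prod>k<N. \<Prod>j<k. complex_of_int (S k T \<omega>) + (-1) * complex_of_int (S j T \<omega>)) =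
      (\<lambda>\<omega>. complex_of_real (vandermonde N (\<lambda>j. real_of_int (S j T \<omega>))))"
    by (simp add: vandermonde_def)
  finally show ?thesis .
qed

end

subsection \<open>Integration over the imaginary parts\<close>

text \<open>The second factor has mass 1, so the first marginal of the product is \<open>M\<close>
  itself.\<close>

lemma all_moments_fst:
  assumes "prob_space M'" and f: "all_moments M f"
  shows "all_moments (M \<Otimes>\<^sub>M M') (\<lambda>p. f (fst p))"
proof -
  have [measurable]: "f \<in> borel_measurable M" using f by (rule all_moments_measurable)
  have "integrable (distr (M \<Otimes>\<^sub>M M') M fst) (\<lambda>x. norm (f x) ^ n)" for n
    using f by (simp add: prob_space.distr_pair_fst[OF assms(1)] all_moments_def)
  then have "integrable (M \<Otimes>\<^sub>M M') (\<lambda>p. norm (f (fst p)) ^ n)" for n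
    by (subst (asm) integrable_distr_eq) auto
  then show ?thesis by (simp add: all_moments_def)
qed

lemma all_moments_snd:
  assumes M: "prob_space M" and M': "prob_space M'" and f: "all_moments M' f"
  shows "all_moments (M \<Otimes>\<^sub>M M') (\<lambda>p. f (snd p))"
proof -
  interpret M: prob_space M by fact
  interpret M': prob_space M' by fact
  interpret pair_sigma_finite M M' ..
  have [measurable]: "f \<in> borel_measurable M'" using f by (rule all_moments_measurable)
  have "integrable (M' \<Otimes>\<^sub>M M) (\<lambda>p. norm (f (fst p)) ^ n)" for n
    using all_moments_fst[OF M f] by (simp add: all_moments_def)
  then have "integrable (M \<Otimes>\<^sub>M M') (\<lambda>p. norm (f (snd p)) ^ n)" for n
    using integrable_product_swap_iff[of "\<lambda>p. norm (f (snd p)) ^ n"] by (simp add: case_prod_unfold)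
  then show ?thesis by (simp add: all_moments_def)
qed

lemma (in sech_walks) all_moments_Phi_imag_walk:
  assumes "j < N"
  shows "all_moments M' (\<lambda>\<omega>. Phi N u k (of_int x + \<i> * of_real (imag_walk \<zeta> j t \<omega>)))"
  using assms
  by (intro all_moments_Phi all_moments_add all_moments_mult all_moments_const all_moments_imag_walk
      finite_measure_axioms)

text \<open>The rows of the matrix are independent, so the expectation can be moved inside the determinant.\<close>

lemma (in sech_walks) expectation_det_Phi:
  "(\<integral>\<omega>. Determinant.det (mat N N (\<lambda>(j, k). Phi N u k (of_int (x j) + \<i> * of_real (imag_walk \<zeta> j t \<omega>)))) \<partial>M')
     = det_mart N u M' \<zeta> t x"
proof -
  let ?f = "\<lambda>j k \<omega>. Phi N u k (of_int (x j) + \<i> * of_real (imag_walk \<zeta> j t \<omega>))"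
  have lt: "p i < N" if "p permutes {0..<N}" "i \<in> {0..<N}" for p i
    using that permutes_in_image[OF that(1), of i] by simp
  have f: "all_moments M' (?f j k)" if "j < N" for j k
    using that by (rule all_moments_Phi_imag_walk)
  have det: "Determinant.det (mat N N (\<lambda>(j, k). A j k)) =
      (\<Sum>p | p permutes {0..<N}. signof p * (\<Prod>j = 0..<N. A j (p j)))" for A :: "nat \<Rightarrow> nat \<Rightarrow> complex"
    by (subst det_def'[where n = N]) (auto intro!: sum.cong prod.cong dest: lt)
  \<comment> \<open>A term of the Leibniz expansion takes exactly one factor from each row, so the
    integral of the product splits along the independent rows.\<close>
  have prod: "(\<integral>\<omega>. (\<Prod>j = 0..<N. ?f j (p j) \<omega>) \<partial>M') = (\<Prod>j = 0..<N. \<integral>\<omega>. ?f j (p j) \<omega> \<partial>M')" for p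
  proof (rule indep_vars_lebesgue_integral)
    have "indep_vars (\<lambda>_. borel) (\<lambda>j \<omega>. ?f j (p j) \<omega>) {..<N}"
      by (rule indep_vars_compose2[OF imag_walk_indep[of t],
            where Y = "\<lambda>j y. Phi N u (p j) (of_int (x j) + \<i> * of_real y)"]) (simp add: Phi_def)
    then show "indep_vars (\<lambda>_. borel) (\<lambda>j \<omega>. ?f j (p j) \<omega>) {0..<N}"
      by (simp only: lessThan_atLeast0)
  qed (auto intro: all_moments_integrable f)
  have int: "integrable M' (\<lambda>\<omega>. signof p * (\<Prod>j = 0..<N. ?f j (p j) \<omega>))" for p
    by (intro all_moments_integrable all_moments_mult all_moments_prod all_moments_const f
        finite_measure_axioms) auto
  show ?thesis
    unfolding det det_mart_def mart_def
    by (subst Bochner_Integration.integral_sum[OF int]) (simp add: prod)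
qed

section \<open>Removal of the indicator of no collision\<close>

context indep_walks
begin

lemma integrable_functional_vandermonde:
  assumes F: "bounded_path_functional t F"
  shows "integrable M (\<lambda>\<omega>. F (\<lambda>s\<in>{..t}. unlabel N (\<lambda>j. S j s \<omega>)) * vandermonde N (\<lambda>j. real_of_int (S j T \<omega>)))"
  using all_moments_integrable[OF all_moments_mult[OF all_moments_functional[OF F] all_moments_vandermonde]]
  by (simp only: of_real_mult[symmetric] complex_of_real_integrable_eq)

lemma expectation_noncolliding_vandermonde:
  assumes F: "bounded_path_functional t F" and t: "t \<le> T"
  shows "expectation (\<lambda>\<omega>. F (\<lambda>s\<in>{..t}. unlabel N (\<lambda>j. S j s \<omega>))
      * of_bool (enat T < collision_time N S \<omega>) * (vandermonde N (\<lambda>j. real_of_int (S j T \<omega>)) / c))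
    = expectation (\<lambda>\<omega>. F (\<lambda>s\<in>{..t}. unlabel N (\<lambda>j. S j s \<omega>)) * (vandermonde N (\<lambda>j. real_of_int (S j T \<omega>)) / c))"
proof -
  let ?F = "\<lambda>\<omega>. F (\<lambda>s\<in>{..t}. unlabel N (\<lambda>j. S j s \<omega>))"
  let ?h = "\<lambda>\<omega>. vandermonde N (\<lambda>j. real_of_int (S j T \<omega>))"
  let ?C = "\<lambda>\<omega>. of_bool (collides N T (\<lambda>j s. S j s \<omega>)) :: real"
  note Fh = integrable_functional_vandermonde[OF F]
  \<comment> \<open>Dominated by the integrand without the indicator. Both parts must be integrable
    before the integral of the difference is split.\<close>
  have FCh: "integrable M (\<lambda>\<omega>. ?F \<omega> * ?C \<omega> * ?h \<omega>)"
    by (rule Bochner_Integration.integrable_bound[OF Fh])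
       (auto intro!: borel_measurable_times functional_measurable[OF F] vandermonde_walk_measurable
         collides_measurable simp del: of_bool_eq_iff)
  have "expectation (\<lambda>\<omega>. ?F \<omega> * of_bool (enat T < collision_time N S \<omega>) * (?h \<omega> / c)) =
      expectation (\<lambda>\<omega>. (?F \<omega> * ?h \<omega> - ?F \<omega> * ?C \<omega> * ?h \<omega>) / c)"
    by (intro Bochner_Integration.integral_cong) (auto simp: less_collision_time_iff)
  also have "\<dots> = (expectation (\<lambda>\<omega>. ?F \<omega> * ?h \<omega>) - expectation (\<lambda>\<omega>. ?F \<omega> * ?C \<omega> * ?h \<omega>)) / c"
    using Fh FCh by simp
  also have "\<dots> = expectation (\<lambda>\<omega>. ?F \<omega> * ?h \<omega> / c)"
    by (simp add: expectation_collides_vandermonde_eq_0[OF F t])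
  finally show ?thesis by simp
qed

end

theorem proposition3p1:
  fixes N t T :: nat and u :: "nat \<Rightarrow> int"
    and M :: "'a measure" and S :: "nat \<Rightarrow> nat \<Rightarrow> 'a \<Rightarrow> int"
    and M' :: "'b measure" and \<zeta> :: "nat \<Rightarrow> nat \<Rightarrow> 'b \<Rightarrow> real"
    and P :: "'c measure" and \<Xi> :: "nat \<Rightarrow> 'c \<Rightarrow> int measure"
    and F :: "(nat \<Rightarrow> int measure) \<Rightarrow> real"
  assumes "1 \<le> N"
    and "strict_mono_on {..<N} u"
    and "\<And>j. j < N \<Longrightarrow> even (u j)"
    and "1 \<le> t" and "t \<le> T"
    and "independent_walks N u M S"
    and "sech_increments N M' \<zeta>"
    and "noncolliding_walk N u M S P \<Xi>"
    and "bounded_path_functional t F"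
  shows "complex_of_real (\<integral>\<omega>. F (\<lambda>s\<in>{..t}. \<Xi> s \<omega>) \<partial>P) =
           (\<integral>\<omega>. complex_of_real (F (\<lambda>s\<in>{..t}. unlabel N (\<lambda>j. S j s \<omega>)))
                 * det_mart N u M' \<zeta> T (\<lambda>j. S j T \<omega>) \<partial>M)
       \<and> (\<integral>\<omega>. complex_of_real (F (\<lambda>s\<in>{..t}. unlabel N (\<lambda>j. S j s \<omega>)))
                 * det_mart N u M' \<zeta> T (\<lambda>j. S j T \<omega>) \<partial>M) =
           (\<integral>\<omega>. complex_of_real (F (\<lambda>s\<in>{..t}. unlabel N (\<lambda>j. \<lfloor>Re (complex_walk S \<zeta> j s \<omega>)\<rfloor>)))
                 * Determinant.det (mat N N (\<lambda>(j, k). Phi N u k (complex_walk S \<zeta> j T \<omega>)))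
              \<partial>(M \<Otimes>\<^sub>M M'))"
proof -
  have T: "1 \<le> T" using assms by simp
  interpret W: indep_walks N T u M S
    by unfold_locales (use assms T in auto)
  interpret V: sech_walks N M' \<zeta>
    by unfold_locales (use assms in auto)
  interpret pair_prob_space M M' ..
  let ?F = "\<lambda>\<omega>. F (\<lambda>s\<in>{..t}. unlabel N (\<lambda>j. S j s \<omega>))"
  let ?h = "\<lambda>x. vandermonde N (\<lambda>j. real_of_int (x j))"
  have inj: "inj_on u {..<N}"
    using assms(2) by (rule strict_mono_on_imp_inj_on)
  have "(\<integral>\<omega>. F (\<lambda>s\<in>{..t}. \<Xi> s \<omega>) \<partial>P) = (\<integral>\<omega>. F (restrict (\<lambda>s\<in>{..T}. \<Xi> s \<omega>) {..t}) \<partial>P)"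
    using assms(5) by (simp add: restrict_restrict Int_absorb1)
  also have "\<dots> = W.expectation (\<lambda>\<omega>. F (restrict (\<lambda>s\<in>{..T}. unlabel N (\<lambda>j. S j s \<omega>)) {..t})
      * of_bool (enat T < collision_time N S \<omega>) * (?h (\<lambda>j. S j T \<omega>) / ?h u))"
    using assms(8) T bounded_path_functional_restrict[OF assms(9,5)]
    unfolding noncolliding_walk_def by blast
  also have "\<dots> = W.expectation (\<lambda>\<omega>. ?F \<omega> * of_bool (enat T < collision_time N S \<omega>) * (?h (\<lambda>j. S j T \<omega>) / ?h u))"
    using assms(5) by (simp add: restrict_restrict Int_absorb1)
  also have "\<dots> = W.expectation (\<lambda>\<omega>. ?F \<omega> * (?h (\<lambda>j. S j T \<omega>) / ?h u))"
    by (rule W.expectation_noncolliding_vandermonde[OF assms(9,5)])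
  finally have "complex_of_real (\<integral>\<omega>. F (\<lambda>s\<in>{..t}. \<Xi> s \<omega>) \<partial>P) =
      (\<integral>\<omega>. complex_of_real (?F \<omega> * (?h (\<lambda>j. S j T \<omega>) / ?h u)) \<partial>M)"
    by (simp only: integral_complex_of_real)
  \<comment> \<open>The determinant equals the quotient of Vandermonde products at every position
    vector, so the weight is replaced pointwise.\<close>
  then have 1: "complex_of_real (\<integral>\<omega>. F (\<lambda>s\<in>{..t}. \<Xi> s \<omega>) \<partial>P) =
      (\<integral>\<omega>. complex_of_real (?F \<omega>) * det_mart N u M' \<zeta> T (\<lambda>j. S j T \<omega>) \<partial>M)"
    using assms(1) T by (simp only: V.det_mart_eq[OF inj] of_real_mult)
  \<comment> \<open>The integrand of the last expectation with its coordinates separated: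
    \<open>fst p\<close> carries the real parts and \<open>snd p\<close> the imaginary
    parts.\<close>
  let ?G = "\<lambda>p. complex_of_real (?F (fst p)) * Determinant.det (mat N N
    (\<lambda>(j, k). Phi N u k (of_int (S j T (fst p)) + \<i> * of_real (imag_walk \<zeta> j T (snd p)))))"
  have G: "integrable (M \<Otimes>\<^sub>M M') ?G"
  proof (intro all_moments_integrable all_moments_mult all_moments_det all_moments_Phi
      all_moments_add all_moments_const)
    show "all_moments (M \<Otimes>\<^sub>M M') (\<lambda>p. complex_of_real (?F (fst p)))"
      by (rule all_moments_fst[OF V.prob_space_axioms W.all_moments_functional[OF assms(9)]])
    show "all_moments (M \<Otimes>\<^sub>M M') (\<lambda>p. of_int (S j T (fst p)))" if "j < N" for j
      by (rule all_moments_fst[OF V.prob_space_axioms W.all_moments_walk[OF that]])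
    show "all_moments (M \<Otimes>\<^sub>M M') (\<lambda>p. of_real (imag_walk \<zeta> j T (snd p)))" if "j < N" for j
      by (rule all_moments_snd[OF W.prob_space_axioms V.prob_space_axioms V.all_moments_imag_walk[OF that]])
  qed (rule P.finite_measure_axioms)+
  \<comment> \<open>For a fixed first coordinate the functional is a constant, and the inner
    integral averages the determinant with frozen real parts.\<close>
  have "(\<integral>\<omega>. complex_of_real (?F \<omega>) * det_mart N u M' \<zeta> T (\<lambda>j. S j T \<omega>) \<partial>M) =
      (\<integral>\<omega>. (\<integral>\<omega>'. ?G (\<omega>, \<omega>') \<partial>M') \<partial>M)"
    by (simp add: V.expectation_det_Phi)
  also have "\<dots> = integral\<^sup>L (M \<Otimes>\<^sub>M M') ?G"
    by (rule integral_fst'[OF G])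
  \<comment> \<open>The real part is an embedded integer, so the floor returns exactly
    \<open>S j s\<close>.\<close>
  also have "?G = (\<lambda>\<omega>. complex_of_real (F (\<lambda>s\<in>{..t}. unlabel N (\<lambda>j. \<lfloor>Re (complex_walk S \<zeta> j s \<omega>)\<rfloor>)))
                 * Determinant.det (mat N N (\<lambda>(j, k). Phi N u k (complex_walk S \<zeta> j T \<omega>))))"
    by (simp add: complex_walk_def case_prod_unfold)
  finally show ?thesis using 1 by blast
qed

end
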